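(* Let $H$ be a group and let $\langle \mathbf{x}, H; R\rangle$ be an $\mathcal{M}_H$-presentation defining a group $G$. If $G$ is residually finite, then for every integer $n>1$ the group $G_n = \langle \mathbf{x}, H; R^n\rangle$ (the quotient of $H * F$, $F$ the free group on $\mathbf{x}$, by the normal closure of $R^n$) is also residually finite.
   Context: A one-relator relative presentation $\mathcal{P} = \langle \mathbf{x}, H; R\rangle$ consists of a set $\mathbf{x}$, a group $H$, and an expression $R = x_1^{\varepsilon_1} h_1 x_2^{\varepsilon_2} h_2 \cdots x_r^{\varepsilon_r} h_r$ with $r>0$, $x_i \in \mathbf{x}$, $\varepsilon_i = \pm 1$, $h_i \in H$. The word $W = x_1^{\varepsilon_1} x_2^{\varepsilon_2} \cdots x_r^{\varepsilon_r}$ is the $\mathbf{x}$-skeleton of $R$; it is not required to be reduced or cyclically reduced. The group defined by $\mathcal{P}$ is the quotient of the free product $H * F$ ($F$ the free group on $\mathbf{x}$) by the normal closure of the element represented by $R$. A weight function on $\mathbf{x}$ is a function $\theta: \mathbf{x} \to \mathbb{Z}$ whose image generates the additive group $\mathbb{Z}$; it is strict if $\theta(x) \neq 0$ for all $x \in \mathbf{x}$. Given $W$ and $\theta$, define $\phi:\{0,1,\ldots,r\} \to \mathbb{Z}$ by $\phi(j) = \sum_{i=1}^{j} \varepsilon_i \theta(x_i)$ (so $\phi(0)=0$). The weight function is admissible for $W$ if $\phi(r)=0$. $W$ has the unique max-min property if there are an admissible strict weight function $\theta$ and $k,l \in \{1,\ldots,r\}$ such that $\phi(j) < \phi(k)$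 for all $j \in \{1,\ldots,r\}\setminus\{k\}$, $\phi(j) > \phi(l)$ for all $j \in \{1,\ldots,r\}\setminus\{l\}$, $x_k \neq x_{k+1}$ and $x_l \neq x_{l+1}$ (subscripts modulo $r$). An $\mathcal{M}_H$-presentation is a one-relator relative presentation $\langle \mathbf{x}, H; R\rangle$ whose $\mathbf{x}$-skeleton has the unique max-min property. *)

theory Defs
  imports "HOL-Algebra.Elementary_Groups"
begin

section \<open>Words modulo a congruence\<close>

inductive_set word_cong :: "'a set \<Rightarrow> ('a list \<times> 'a list) set \<Rightarrow> ('a list \<times> 'a list) set"
  for A S where
    rel: "(u, v) \<in> S \<Longrightarrow> u \<in> lists A \<Longrightarrow> v \<in> lists A \<Longrightarrow> p \<in> lists A \<Longrightarrow> q \<in> lists A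
          \<Longrightarrow> (p @ u @ q, p @ v @ q) \<in> word_cong A S"
  | refl: "u \<in> lists A \<Longrightarrow> (u, u) \<in> word_cong A S"
  | sym: "(u, v) \<in> word_cong A S \<Longrightarrow> (v, u) \<in> word_cong A S"
  | trans: "(u, v) \<in> word_cong A S \<Longrightarrow> (v, w) \<in> word_cong A S \<Longrightarrow> (u, w) \<in> word_cong A S"

definition word_class :: "'a set \<Rightarrow> ('a list \<times> 'a list) set \<Rightarrow> 'a list \<Rightarrow> 'a list set"
  where "word_class A S u = word_cong A S `` {u}"

definition word_monoid :: "'a set \<Rightarrow> ('a list \<times> 'a list) set \<Rightarrow> 'a list set monoid"
  where "word_monoid A S =
    \<lparr> carrier = lists A // word_cong A S,
      monoid.mult = (\<lambda>C D. \<Union>u\<in>C. \<Union>v\<in>D. word_class A S (u @ v)),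
      monoid.one = word_class A S [] \<rparr>"

lemma word_cong_lists:
  "(u, v) \<in> word_cong A S \<Longrightarrow> u \<in> lists A \<and> v \<in> lists A"
  by (induction rule: word_cong.induct) auto

context
  notes in_listsD [rule del] in_listsI [rule del]
    InlI [simp] InrI [simp]
begin

lemma equiv_word_cong: "equiv (lists A) (word_cong A S)"
proof (rule equivI)
  show "word_cong A S \<subseteq> lists A \<times> lists A"
    using word_cong_lists by fastforce
  show "refl_on (lists A) (word_cong A S)"
    by (auto simp: refl_on_def intro: word_cong.refl)
  show "sym (word_cong A S)"
    by (auto simp: sym_def intro: word_cong.sym)
  show "trans (word_cong A S)"
    by (auto simp: trans_def intro: word_cong.trans)
qed

lemma word_cong_context:
  "(u, v) \<in> word_cong A S \<Longrightarrow> p \<in> lists A \<Longrightarrow> q \<in> lists A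
    \<Longrightarrow> (p @ u @ q, p @ v @ q) \<in> word_cong A S"
proof (induction rule: word_cong.induct)
  case (rel u v p' q')
  then show ?case
    using word_cong.rel[of u v S A "p @ p'" "q' @ q"] by simp
next
  case (refl u)
  then show ?case by (simp add: word_cong.refl)
next
  case (sym u v)
  then show ?case by (auto intro: word_cong.sym)
next
  case (trans u v w)
  then show ?case by (blast intro: word_cong.trans)
qed

lemma word_cong_append:
  assumes "(u, u') \<in> word_cong A S" "(v, v') \<in> word_cong A S"
  shows "(u @ v, u' @ v') \<in> word_cong A S"
proof -
  have "(u @ v, u' @ v) \<in> word_cong A S"
    using word_cong_context[OF assms(1), of "[]" v] word_cong_lists[OF assms(2)] by simp
  moreover have "(u' @ v, u' @ v') \<in> word_cong A S"
    using word_cong_context[OF assms(2), of u' "[]"] word_cong_lists[OF assms(1)] by simp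
  ultimately show ?thesis by (rule word_cong.trans)
qed

lemma word_class_eq_iff:
  "u \<in> lists A \<Longrightarrow> v \<in> lists A \<Longrightarrow>
    word_class A S u = word_class A S v \<longleftrightarrow> (u, v) \<in> word_cong A S"
  unfolding word_class_def using eq_equiv_class_iff[OF equiv_word_cong] by blast

lemma carrier_word_monoid: "carrier (word_monoid A S) = word_class A S ` lists A"
  by (auto simp: word_monoid_def word_class_def quotient_def)

lemma one_word_monoid: "\<one>\<^bsub>word_monoid A S\<^esub> = word_class A S []"
  by (simp add: word_monoid_def)

lemma mult_word_monoid:
  assumes "u \<in> lists A" "v \<in> lists A"
  shows "word_class A S u \<otimes>\<^bsub>word_monoid A S\<^esub> word_class A S v = word_class A S (u @ v)"
proof -
  have "congruent2 (word_cong A S) (word_cong A S) (\<lambda>u v. word_class A S (u @ v))"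
    unfolding congruent2_def word_class_def
    using equiv_class_eq[OF equiv_word_cong] word_cong_append by fast
  from UN_equiv_class2[OF equiv_word_cong equiv_word_cong this assms]
  show ?thesis by (simp add: word_monoid_def word_class_def)
qed

lemma monoid_word_monoid: "monoid (word_monoid A S)"
  by (rule monoidI) (auto simp: carrier_word_monoid one_word_monoid mult_word_monoid)

lemma group_word_monoid:
  assumes inv: "\<And>a. a \<in> A \<Longrightarrow> \<exists>b\<in>A. ([b, a], []) \<in> word_cong A S"
  shows "group (word_monoid A S)"
proof (rule monoid.group_l_invI[OF monoid_word_monoid])
  fix x assume "x \<in> carrier (word_monoid A S)"
  then obtain u where u: "u \<in> lists A" "x = word_class A S u"
    by (auto simp: carrier_word_monoid)
  have "\<exists>v\<in>lists A. (v @ u, []) \<in> word_cong A S"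
    using u(1)
  proof (induction u)
    case Nil
    then show ?case by (intro bexI[of _ "[]"]) (simp_all add: word_cong.refl)
  next
    case (Cons a u)
    then obtain v where v: "v \<in> lists A" "(v @ u, []) \<in> word_cong A S" by auto
    obtain b where b: "b \<in> A" "([b, a], []) \<in> word_cong A S"
      using inv[of a] Cons.hyps by blast
    have "(v @ [b, a] @ u, v @ [] @ u) \<in> word_cong A S"
      using b v Cons.hyps Cons.prems word_cong_context[OF b(2), of v u] by simp
    then have "((v @ [b]) @ a # u, []) \<in> word_cong A S"
      using v(2) word_cong.trans[of "v @ [b, a] @ u" "v @ u" A S "[]"] by simp
    then show ?case
      using v(1) b(1) by (intro bexI[of _ "v @ [b]"]) auto
  qed
  then obtain v where v: "v \<in> lists A" "(v @ u, []) \<in> word_cong A S" by auto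
  then have "word_class A S v \<otimes>\<^bsub>word_monoid A S\<^esub> x = \<one>\<^bsub>word_monoid A S\<^esub>"
    using u by (simp add: one_word_monoid mult_word_monoid word_class_eq_iff)
  moreover have "word_class A S v \<in> carrier (word_monoid A S)"
    using v(1) by (simp add: carrier_word_monoid)
  ultimately show "\<exists>y\<in>carrier (word_monoid A S). y \<otimes>\<^bsub>word_monoid A S\<^esub> x = \<one>\<^bsub>word_monoid A S\<^esub>"
    by blast
qed

lemma word_monoid_hom_exists:
  assumes "monoid K" and f: "\<And>a. a \<in> A \<Longrightarrow> f a \<in> carrier K"
    and S: "\<And>u v. (u, v) \<in> S \<Longrightarrow> u \<in> lists A \<Longrightarrow> v \<in> lists A \<Longrightarrow>
      foldr (\<lambda>a g. f a \<otimes>\<^bsub>K\<^esub> g) u \<one>\<^bsub>K\<^esub> = foldr (\<lambda>a g. f a \<otimes>\<^bsub>K\<^esub> g) v \<one>\<^bsub>K\<^esub>"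
  shows "\<exists>h\<in>hom (word_monoid A S) K. \<forall>a\<in>A. h (word_class A S [a]) = f a"
proof -
  interpret K: monoid K by fact
  define e where "e u = foldr (\<lambda>a g. f a \<otimes>\<^bsub>K\<^esub> g) u \<one>\<^bsub>K\<^esub>" for u
  have ec: "e u \<in> carrier K" if "u \<in> lists A" for u
    using that by (induction u) (auto simp: e_def f)
  have ea: "e (u @ v) = e u \<otimes>\<^bsub>K\<^esub> e v" if "u \<in> lists A" "v \<in> lists A" for u v
    using that(1)
  proof (induction u)
    case Nil
    then show ?case using ec[OF that(2)] by (simp add: e_def)
  next
    case (Cons a u)
    then show ?case using ec[OF that(2)] ec[of u] f[of a] by (simp add: e_def K.m_assoc)
  qed
  have e_cong: "e u = e v" if "(u, v) \<in> word_cong A S" for u v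
    using that
  proof (induction rule: word_cong.induct)
    case (rel u v p q)
    then show ?case using S[of u v] by (simp add: ea flip: e_def)
  qed auto
  define h where "h C = e (SOME u. u \<in> C)" for C
  have h: "h (word_class A S u) = e u" if "u \<in> lists A" for u
  proof -
    have "u \<in> word_class A S u"
      using that by (simp add: word_class_def word_cong.refl)
    then have "(SOME v. v \<in> word_class A S u) \<in> word_class A S u" by (rule someI)
    then show ?thesis using e_cong by (simp add: h_def word_class_def)
  qed
  have "h \<in> hom (word_monoid A S) K"
    by (auto simp: hom_def carrier_word_monoid mult_word_monoid h ec ea)
  moreover have "\<forall>a\<in>A. h (word_class A S [a]) = f a"
    using f h by (auto simp: e_def)
  ultimately show ?thesis by blast
qed

end

section \<open>Free groups and free products\<close>

text \<open>The letter \<open>(x, True)\<close> stands for \<open>x\<close> and \<open>(x, False)\<close> for its formal inverse.\<close>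

definition free_group_rels :: "'x set \<Rightarrow> (('x \<times> bool) list \<times> ('x \<times> bool) list) set"
  where "free_group_rels Xs = {([(x, b), (x, \<not> b)], []) | x b. x \<in> Xs}"

definition free_group :: "'x set \<Rightarrow> ('x \<times> bool) list set monoid"
  where "free_group Xs = word_monoid (Xs \<times> UNIV) (free_group_rels Xs)"

definition free_gen :: "'x set \<Rightarrow> 'x \<Rightarrow> ('x \<times> bool) list set"
  where "free_gen Xs x = word_class (Xs \<times> UNIV) (free_group_rels Xs) [(x, True)]"

definition free_product_rels ::
    "('a, 'c) monoid_scheme \<Rightarrow> ('b, 'd) monoid_scheme \<Rightarrow> (('a + 'b) list \<times> ('a + 'b) list) set"
  where "free_product_rels G K =
      {([Inl a, Inl b], [Inl (a \<otimes>\<^bsub>G\<^esub> b)]) | a b. a \<in> carrier G \<and> b \<in> carrier G}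
    \<union> {([Inr a, Inr b], [Inr (a \<otimes>\<^bsub>K\<^esub> b)]) | a b. a \<in> carrier K \<and> b \<in> carrier K}
    \<union> {([Inl \<one>\<^bsub>G\<^esub>], []), ([Inr \<one>\<^bsub>K\<^esub>], [])}"

definition free_product ::
    "('a, 'c) monoid_scheme \<Rightarrow> ('b, 'd) monoid_scheme \<Rightarrow> ('a + 'b) list set monoid"
  where "free_product G K = word_monoid (carrier G <+> carrier K) (free_product_rels G K)"

definition free_product_inl ::
    "('a, 'c) monoid_scheme \<Rightarrow> ('b, 'd) monoid_scheme \<Rightarrow> 'a \<Rightarrow> ('a + 'b) list set"
  where "free_product_inl G K a =
    word_class (carrier G <+> carrier K) (free_product_rels G K) [Inl a]"

definition free_product_inr ::
    "('a, 'c) monoid_scheme \<Rightarrow> ('b, 'd) monoid_scheme \<Rightarrow> 'b \<Rightarrow> ('a + 'b) list set"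
  where "free_product_inr G K b =
    word_class (carrier G <+> carrier K) (free_product_rels G K) [Inr b]"

context
  notes in_listsD [rule del] in_listsI [rule del]
    InlI [simp] InrI [simp]
begin

lemma group_free_group: "group (free_group Xs)"
  unfolding free_group_def
proof (rule group_word_monoid)
  fix a assume "a \<in> Xs \<times> (UNIV :: bool set)"
  then obtain x b where a: "a = (x, b)" "x \<in> Xs" by auto
  have "([(x, \<not> b), (x, \<not> \<not> b)], []) \<in> free_group_rels Xs"
    using a by (auto simp: free_group_rels_def)
  from word_cong.rel[OF this, of "Xs \<times> UNIV" "[]" "[]"]
  show "\<exists>c\<in>Xs \<times> UNIV. ([c, a], []) \<in> word_cong (Xs \<times> UNIV) (free_group_rels Xs)"
    using a by (intro bexI[of _ "(x, \<not> b)"]) auto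
qed

lemma free_gen_closed: "x \<in> Xs \<Longrightarrow> free_gen Xs x \<in> carrier (free_group Xs)"
  by (auto simp: free_gen_def free_group_def carrier_word_monoid)

lemma free_group_hom_exists:
  assumes "group K" and f: "\<And>x. x \<in> Xs \<Longrightarrow> f x \<in> carrier K"
  shows "\<exists>h\<in>hom (free_group Xs) K. \<forall>x\<in>Xs. h (free_gen Xs x) = f x"
proof -
  interpret K: group K by fact
  define g where "g = (\<lambda>(x, b). if b then f x else inv\<^bsub>K\<^esub> f x)"
  have "\<exists>h\<in>hom (word_monoid (Xs \<times> UNIV) (free_group_rels Xs)) K.
          \<forall>a\<in>Xs \<times> UNIV. h (word_class (Xs \<times> UNIV) (free_group_rels Xs) [a]) = g a"
    by (rule word_monoid_hom_exists)
       (auto simp: g_def f K.monoid_axioms free_group_rels_def)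
  then obtain h where h: "h \<in> hom (free_group Xs) K"
      "\<forall>a\<in>Xs \<times> UNIV. h (word_class (Xs \<times> UNIV) (free_group_rels Xs) [a]) = g a"
    unfolding free_group_def by blast
  then have "\<forall>x\<in>Xs. h (free_gen Xs x) = f x"
    by (simp add: free_gen_def g_def)
  with h(1) show ?thesis by blast
qed

lemma group_free_product:
  assumes "group G" "group K"
  shows "group (free_product G K)"
  unfolding free_product_def
proof (rule group_word_monoid)
  interpret G: group G by fact
  interpret K: group K by fact
  let ?A = "carrier G <+> carrier K" and ?S = "free_product_rels G K"
  fix a assume "a \<in> ?A"
  then consider x where "a = Inl x" "x \<in> carrier G" | x where "a = Inr x" "x \<in> carrier K"
    by auto
  then show "\<exists>b\<in>?A. ([b, a], []) \<in> word_cong ?A ?S"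
  proof cases
    case 1
    have r1: "([Inl (inv\<^bsub>G\<^esub> x), Inl x], [Inl (inv\<^bsub>G\<^esub> x \<otimes>\<^bsub>G\<^esub> x)]) \<in> ?S"
      using 1 by (auto simp: free_product_rels_def simp del: G.l_inv)
    have r2: "([Inl \<one>\<^bsub>G\<^esub>], []) \<in> ?S"
      by (auto simp: free_product_rels_def)
    have "([Inl (inv\<^bsub>G\<^esub> x), Inl x], [Inl \<one>\<^bsub>G\<^esub>]) \<in> word_cong ?A ?S"
      using word_cong.rel[OF r1, of ?A "[]" "[]"] 1 by simp
    moreover have "([Inl \<one>\<^bsub>G\<^esub>], []) \<in> word_cong ?A ?S"
      using word_cong.rel[OF r2, of ?A "[]" "[]"] by auto
    ultimately have "([Inl (inv\<^bsub>G\<^esub> x), Inl x], []) \<in> word_cong ?A ?S"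
      by (rule word_cong.trans)
    then show ?thesis
      using 1 by (intro bexI[of _ "Inl (inv\<^bsub>G\<^esub> x)"]) auto
  next
    case 2
    have r1: "([Inr (inv\<^bsub>K\<^esub> x), Inr x], [Inr (inv\<^bsub>K\<^esub> x \<otimes>\<^bsub>K\<^esub> x)]) \<in> ?S"
      using 2 by (auto simp: free_product_rels_def simp del: K.l_inv)
    have r2: "([Inr \<one>\<^bsub>K\<^esub>], []) \<in> ?S"
      by (auto simp: free_product_rels_def)
    have "([Inr (inv\<^bsub>K\<^esub> x), Inr x], [Inr \<one>\<^bsub>K\<^esub>]) \<in> word_cong ?A ?S"
      using word_cong.rel[OF r1, of ?A "[]" "[]"] 2 by simp
    moreover have "([Inr \<one>\<^bsub>K\<^esub>], []) \<in> word_cong ?A ?S"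
      using word_cong.rel[OF r2, of ?A "[]" "[]"] by auto
    ultimately have "([Inr (inv\<^bsub>K\<^esub> x), Inr x], []) \<in> word_cong ?A ?S"
      by (rule word_cong.trans)
    then show ?thesis
      using 2 by (intro bexI[of _ "Inr (inv\<^bsub>K\<^esub> x)"]) auto
  qed
qed

lemma free_product_inl_hom: "monoid G \<Longrightarrow> free_product_inl G K \<in> hom G (free_product G K)"
proof (rule homI)
  assume "monoid G"
  then interpret G: monoid G .
  let ?A = "carrier G <+> carrier K" and ?S = "free_product_rels G K"
  fix a assume a: "a \<in> carrier G"
  then show "free_product_inl G K a \<in> carrier (free_product G K)"
    by (auto simp: free_product_inl_def free_product_def carrier_word_monoid)
  fix b assume b: "b \<in> carrier G"
  have "([Inl a, Inl b], [Inl (a \<otimes>\<^bsub>G\<^esub> b)]) \<in> ?S"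
    using a b by (auto simp: free_product_rels_def)
  from word_cong.rel[OF this, of ?A "[]" "[]"]
  show "free_product_inl G K (a \<otimes>\<^bsub>G\<^esub> b)
      = free_product_inl G K a \<otimes>\<^bsub>free_product G K\<^esub> free_product_inl G K b"
    using a b
    by (auto simp: free_product_inl_def free_product_def mult_word_monoid word_class_eq_iff
             intro: word_cong.sym)
qed

lemma free_product_inr_hom: "monoid K \<Longrightarrow> free_product_inr G K \<in> hom K (free_product G K)"
proof (rule homI)
  assume "monoid K"
  then interpret K: monoid K .
  let ?A = "carrier G <+> carrier K" and ?S = "free_product_rels G K"
  fix a assume a: "a \<in> carrier K"
  then show "free_product_inr G K a \<in> carrier (free_product G K)"
    by (auto simp: free_product_inr_def free_product_def carrier_word_monoid)
  fix b assume b: "b \<in> carrier K"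
  have "([Inr a, Inr b], [Inr (a \<otimes>\<^bsub>K\<^esub> b)]) \<in> ?S"
    using a b by (auto simp: free_product_rels_def)
  from word_cong.rel[OF this, of ?A "[]" "[]"]
  show "free_product_inr G K (a \<otimes>\<^bsub>K\<^esub> b)
      = free_product_inr G K a \<otimes>\<^bsub>free_product G K\<^esub> free_product_inr G K b"
    using a b
    by (auto simp: free_product_inr_def free_product_def mult_word_monoid word_class_eq_iff
             intro: word_cong.sym)
qed

lemma free_product_hom_exists:
  assumes "group G" "group K" "group L" and f: "f \<in> hom G L" and g: "g \<in> hom K L"
  shows "\<exists>h\<in>hom (free_product G K) L.
    (\<forall>a\<in>carrier G. h (free_product_inl G K a) = f a) \<and>
    (\<forall>b\<in>carrier K. h (free_product_inr G K b) = g b)"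
proof -
  interpret L: group L by fact
  have one: "f \<one>\<^bsub>G\<^esub> = \<one>\<^bsub>L\<^esub>" "g \<one>\<^bsub>K\<^esub> = \<one>\<^bsub>L\<^esub>"
    using assms by (auto intro: hom_one)
  have closed: "\<And>a. a \<in> carrier G \<Longrightarrow> f a \<in> carrier L" "\<And>b. b \<in> carrier K \<Longrightarrow> g b \<in> carrier L"
    using f g by (auto simp: hom_def)
  have "\<exists>h\<in>hom (word_monoid (carrier G <+> carrier K) (free_product_rels G K)) L.
      \<forall>a\<in>carrier G <+> carrier K.
        h (word_class (carrier G <+> carrier K) (free_product_rels G K) [a]) = case_sum f g a"
    by (rule word_monoid_hom_exists)
       (auto simp: L.monoid_axioms closed free_product_rels_def one L.m_assoc
                   hom_mult[OF f] hom_mult[OF g])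
  then obtain h where h: "h \<in> hom (free_product G K) L"
      "\<forall>a\<in>carrier G <+> carrier K.
        h (word_class (carrier G <+> carrier K) (free_product_rels G K) [a]) = case_sum f g a"
    unfolding free_product_def by blast
  then have "\<forall>a\<in>carrier G. h (free_product_inl G K a) = f a"
      "\<forall>b\<in>carrier K. h (free_product_inr G K b) = g b"
    by (simp_all add: free_product_inl_def free_product_inr_def InlI InrI)
  with h(1) show ?thesis by blast
qed

end

section \<open>Normal closure and residual finiteness\<close>

definition normal_closure :: "('a, 'c) monoid_scheme \<Rightarrow> 'a set \<Rightarrow> 'a set"
  where "normal_closure G S = \<Inter> {N. N \<lhd> G \<and> S \<subseteq> N}"

lemma (in group) normal_closure_normal:
  assumes "S \<subseteq> carrier G"
  shows "normal_closure G S \<lhd> G"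
proof -
  have c: "carrier G \<lhd> G"
    by (rule normal_invI) (auto intro: subgroup_self)
  show ?thesis
    unfolding normal_closure_def
  proof (rule normal_invI)
    show "subgroup (\<Inter> {N. N \<lhd> G \<and> S \<subseteq> N}) G"
      using c assms by (intro subgroups_Inter) (auto simp: normal_def)
    show "x \<otimes> h \<otimes> inv x \<in> \<Inter> {N. N \<lhd> G \<and> S \<subseteq> N}"
      if "x \<in> carrier G" "h \<in> \<Inter> {N. N \<lhd> G \<and> S \<subseteq> N}" for x h
      using that by (auto simp: normal_inv_iff)
  qed
qed

definition residually_finite :: "('a, 'c) monoid_scheme \<Rightarrow> bool"
  where "residually_finite G \<longleftrightarrow> group G \<and>
    (\<forall>g\<in>carrier G. g \<noteq> \<one>\<^bsub>G\<^esub> \<longrightarrow> (\<exists>N. N \<lhd> G \<and> finite (carrier (G Mod N)) \<and> g \<notin> N))"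

section \<open>One-relator relative presentations\<close>

text \<open>The list \<open>[(x\<^sub>1, e\<^sub>1, h\<^sub>1), \<dots>, (x\<^sub>r, e\<^sub>r, h\<^sub>r)]\<close> encodes the expression
  \<open>(x\<^sub>1 ^ e\<^sub>1) h\<^sub>1 \<dots> (x\<^sub>r ^ e\<^sub>r) h\<^sub>r\<close>.\<close>

definition relative_presentation ::
    "'x set \<Rightarrow> ('h, 'c) monoid_scheme \<Rightarrow> ('x \<times> int \<times> 'h) list \<Rightarrow> bool"
  where "relative_presentation Xs H R \<longleftrightarrow> group H \<and> R \<noteq> [] \<and>
    (\<forall>(x, e, h)\<in>set R. x \<in> Xs \<and> (e = 1 \<or> e = -1) \<and> h \<in> carrier H)"

definition skeleton :: "('x \<times> int \<times> 'h) list \<Rightarrow> ('x \<times> int) list"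
  where "skeleton R = map (\<lambda>(x, e, h). (x, e)) R"

abbreviation ambient_group ::
    "'x set \<Rightarrow> ('h, 'c) monoid_scheme \<Rightarrow> ('h + ('x \<times> bool) list set) list set monoid"
  where "ambient_group Xs H \<equiv> free_product H (free_group Xs)"

definition relator ::
    "'x set \<Rightarrow> ('h, 'c) monoid_scheme \<Rightarrow> ('x \<times> int \<times> 'h) list
      \<Rightarrow> ('h + ('x \<times> bool) list set) list set"
  where "relator Xs H R = foldr (\<lambda>(x, e, h) g.
      free_product_inr H (free_group Xs) (free_gen Xs x) [^]\<^bsub>ambient_group Xs H\<^esub> e
      \<otimes>\<^bsub>ambient_group Xs H\<^esub> free_product_inl H (free_group Xs) h
      \<otimes>\<^bsub>ambient_group Xs H\<^esub> g) R \<one>\<^bsub>ambient_group Xs H\<^esub>"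

definition presented_group ::
    "'x set \<Rightarrow> ('h, 'c) monoid_scheme \<Rightarrow> ('h + ('x \<times> bool) list set) list set
      \<Rightarrow> ('h + ('x \<times> bool) list set) list set set monoid"
  where "presented_group Xs H w = ambient_group Xs H Mod normal_closure (ambient_group Xs H) {w}"

lemma group_ambient_group: "group H \<Longrightarrow> group (ambient_group Xs H)"
  by (simp add: group_free_product group_free_group)

lemma relator_closed:
  assumes "relative_presentation Xs H R"
  shows "relator Xs H R \<in> carrier (ambient_group Xs H)"
proof -
  have H: "group H" using assms by (simp add: relative_presentation_def)
  interpret A: group "ambient_group Xs H" by (rule group_ambient_group[OF H])
  have l: "free_product_inl H (free_group Xs) h \<in> carrier (ambient_group Xs H)"
    if "h \<in> carrier H" for h
    using free_product_inl_hom[OF group.is_monoid[OF H], of "free_group Xs"] that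
    by (auto simp: hom_def)
  have r: "free_product_inr H (free_group Xs) (free_gen Xs x) \<in> carrier (ambient_group Xs H)"
    if "x \<in> Xs" for x
    using free_product_inr_hom[OF group.is_monoid[OF group_free_group], of H Xs]
      free_gen_closed[OF that] by (auto simp: hom_def)
  have "\<forall>(x, e, h)\<in>set R. x \<in> Xs \<and> h \<in> carrier H"
    using assms by (auto simp: relative_presentation_def)
  then show ?thesis
    unfolding relator_def by (induction R) (auto intro!: l r)
qed

lemma group_presented_group:
  assumes "group H" "w \<in> carrier (ambient_group Xs H)"
  shows "group (presented_group Xs H w)"
  unfolding presented_group_def
  using assms
  by (intro normal.factorgroup_is_group group.normal_closure_normal group_ambient_group) auto

section \<open>The unique max-min property\<close>

definition weight_function :: "'x set \<Rightarrow> ('x \<Rightarrow> int) \<Rightarrow> bool"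
  where "weight_function Xs \<theta> \<longleftrightarrow> generate integer_group (\<theta> ` Xs) = carrier integer_group"

definition strict_weight :: "'x set \<Rightarrow> ('x \<Rightarrow> int) \<Rightarrow> bool"
  where "strict_weight Xs \<theta> \<longleftrightarrow> (\<forall>x\<in>Xs. \<theta> x \<noteq> 0)"

text \<open>Words are numbered from 1, so the \<open>i\<close>-th letter of \<open>W\<close> is \<open>W ! (i - 1)\<close>, and its
  cyclic successor is \<open>W ! (i mod length W)\<close>.\<close>

definition height :: "('x \<Rightarrow> int) \<Rightarrow> ('x \<times> int) list \<Rightarrow> nat \<Rightarrow> int"
  where "height \<theta> W j = (\<Sum>i=1..j. snd (W ! (i - 1)) * \<theta> (fst (W ! (i - 1))))"

definition admissible_weight :: "('x \<Rightarrow> int) \<Rightarrow> ('x \<times> int) list \<Rightarrow> bool"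
  where "admissible_weight \<theta> W \<longleftrightarrow> height \<theta> W (length W) = 0"

definition unique_max_min :: "'x set \<Rightarrow> ('x \<times> int) list \<Rightarrow> bool"
  where "unique_max_min Xs W \<longleftrightarrow> (\<exists>\<theta> k l.
    weight_function Xs \<theta> \<and> strict_weight Xs \<theta> \<and> admissible_weight \<theta> W \<and>
    k \<in> {1..length W} \<and> l \<in> {1..length W} \<and>
    (\<forall>j\<in>{1..length W} - {k}. height \<theta> W j < height \<theta> W k) \<and>
    (\<forall>j\<in>{1..length W} - {l}. height \<theta> W j > height \<theta> W l) \<and>
    fst (W ! (k - 1)) \<noteq> fst (W ! (k mod length W)) \<and>
    fst (W ! (l - 1)) \<noteq> fst (W ! (l mod length W)))"

definition M_presentation ::
    "'x set \<Rightarrow> ('h, 'c) monoid_scheme \<Rightarrow> ('x \<times> int \<times> 'h) list \<Rightarrow> bool"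
  where "M_presentation Xs H R \<longleftrightarrow>
    relative_presentation Xs H R \<and> unique_max_min Xs (skeleton R)"

end

(* A labelling of the integers by elements of a group P, with loops labelled by H and edges from i to
   i + \<theta> x labelled by the generators x, is a homomorphism from H * F to a wreath product of P with \<int>
   (or with \<int> / N if the labels are N-periodic). It kills R^n iff the label V_j of the closed path
   spelled by R from j satisfies V_j^n = 1 for all j. By the unique max-min property the equations
   V_j = z_j form a recurrence, solvable uniquely in both directions, for the labels of one letter: all
   other labels and the z_j with z_j^n = 1 are free parameters.
   Taking P = H shows that H embeds in G, hence is residually finite. Solving the recurrence over the
   free product K of copies of H, \<int> and \<int> / n that freely provides the parameters gives a labelling
   that detects every g outside the normal closure of R^n, because mapping each parameter to the
   constant it would have in G_n recovers g. As K is residually finite, g is detected over a finite group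
   P. Changing the parameters far away makes them periodic; the recurrence is then a reversible
   system with finitely many states, so its solution is periodic as well, and this yields a
   finite quotient of G_n in which g survives. *)

theory Submission
  imports Defs "HOL-Algebra.Sym_Groups"
begin

section \<open>Residual finiteness\<close>

text \<open>The equations are recurrences because the closed path spelled by \<open>R\<close>
  traverses the highest edge carrying the top letter exactly once: the letter next to it at the peak
  is a different generator. So that unknown occurs in a single factor of V_j and can be isolated by
  cancellation in any group; likewise at the bottom. Top and bottom letters may differ; then both
  are expressed through one sequence of unknowns. The obstacle is that G_n carries an obvious
  labelling, the constant one by the images of the generators, but no finite quotients of G_n are
  available to start from. Hence this labelling is lifted to K, where the parameters satisfy nothing
  beyond what is forced on them; the lift is in general no longer constant. Uniqueness of solutions
  enters three times: the lift maps back to the constant labelling, changes of the parameters far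
  away leave the labels near 0 intact, and two translates that agree on one window coincide. The
  second use needs uniqueness in a bounded form, from equations near 0 only.\<close>

lemma (in group_hom) finite_FactGroup_kernel:
  assumes "finite (carrier H)"
  shows "finite (carrier (G Mod kernel G H h))"
proof -
  have "(\<lambda>X. the_elem (h ` X)) ` carrier (G Mod kernel G H h) \<subseteq> carrier H"
    using FactGroup_the_elem_mem by blast
  then show ?thesis
    using FactGroup_inj_on assms by (meson finite_imageD finite_subset)
qed

lemma finite_index_kernel:
  assumes "group G" "group P" "finite (carrier P)" "\<phi> \<in> hom G P" "g \<in> carrier G" "\<phi> g \<noteq> \<one>\<^bsub>P\<^esub>"
  shows "\<exists>N. N \<lhd> G \<and> finite (carrier (G Mod N)) \<and> g \<notin> N"
proof -
  interpret group_hom G P \<phi>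
    using assms by (simp add: group_hom_def group_hom_axioms_def)
  show ?thesis
    using normal_kernel finite_FactGroup_kernel assms(3,6) by (auto simp: kernel_def)
qed

lemma residually_finite_quotient:
  assumes "residually_finite G" "g \<in> carrier G" "g \<noteq> \<one>\<^bsub>G\<^esub>"
  obtains N where "N \<lhd> G" "group (G Mod N)" "finite (carrier (G Mod N))"
    "(#>\<^bsub>G\<^esub>) N \<in> hom G (G Mod N)" "N #>\<^bsub>G\<^esub> g \<noteq> \<one>\<^bsub>G Mod N\<^esub>"
proof -
  obtain N where N: "N \<lhd> G" "finite (carrier (G Mod N))" "g \<notin> N"
    using assms by (auto simp: residually_finite_def)
  interpret normal N G by fact
  have "N #>\<^bsub>G\<^esub> g \<noteq> N"
    using N(3) assms(2) rcos_self[of g] subgroup_axioms by metis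
  then show ?thesis
    using that N factorgroup_is_group r_coset_hom_Mod by (simp add: FactGroup_def)
qed

lemma residually_finite_of_separating_homs:
  assumes "group G"
    and "\<And>g. g \<in> carrier G \<Longrightarrow> g \<noteq> \<one>\<^bsub>G\<^esub> \<Longrightarrow>
      \<exists>\<phi> \<in> hom G L. \<phi> g \<noteq> \<one>\<^bsub>L\<^esub>"
    and L: "residually_finite L"
  shows "residually_finite G"
  unfolding residually_finite_def
proof (intro conjI ballI impI)
  fix g assume g: "g \<in> carrier G" "g \<noteq> \<one>\<^bsub>G\<^esub>"
  obtain \<phi> where \<phi>: "\<phi> \<in> hom G L" "\<phi> g \<noteq> \<one>\<^bsub>L\<^esub>" using assms(2)[OF g] by blast
  then have "\<phi> g \<in> carrier L" using g by (auto simp: hom_def)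
  then obtain N where N: "N \<lhd> L" "group (L Mod N)" "finite (carrier (L Mod N))"
    "(#>\<^bsub>L\<^esub>) N \<in> hom L (L Mod N)" "N #>\<^bsub>L\<^esub> \<phi> g \<noteq> \<one>\<^bsub>L Mod N\<^esub>"
    using residually_finite_quotient[OF L] \<phi>(2) by metis
  have "(#>\<^bsub>L\<^esub>) N \<circ> \<phi> \<in> hom G (L Mod N)"
    using \<phi>(1) N(4) by (rule hom_compose)
  then show "\<exists>N. N \<lhd> G \<and> finite (carrier (G Mod N)) \<and> g \<notin> N"
    using finite_index_kernel[OF assms(1) N(2,3) _ g(1)] N(5) by auto
qed fact

lemma residually_finite_if_finite:
  assumes "group G" "finite (carrier G)"
  shows "residually_finite G"
  unfolding residually_finite_def
  using assms finite_index_kernel[OF assms(1,1,2), of id] by (auto simp: hom_def)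

lemma residually_finite_DirProd:
  assumes "residually_finite G" "residually_finite K"
  shows "residually_finite (G \<times>\<times> K)"
  unfolding residually_finite_def
proof (intro conjI ballI impI)
  interpret G: group G using assms(1) by (simp add: residually_finite_def)
  interpret K: group K using assms(2) by (simp add: residually_finite_def)
  show D: "group (G \<times>\<times> K)" by (simp add: DirProd_group G.group_axioms K.group_axioms)
  fix g assume g: "g \<in> carrier (G \<times>\<times> K)" "g \<noteq> \<one>\<^bsub>G \<times>\<times> K\<^esub>"
  obtain a b where ab: "g = (a, b)" "a \<in> carrier G" "b \<in> carrier K"
    using g(1) by auto
  show "\<exists>N. N \<lhd> G \<times>\<times> K \<and> finite (carrier ((G \<times>\<times> K) Mod N)) \<and> g \<notin> N"
  proof (cases "a = \<one>\<^bsub>G\<^esub>")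
    case False
    then obtain N where N: "group (G Mod N)" "finite (carrier (G Mod N))"
      "(#>\<^bsub>G\<^esub>) N \<in> hom G (G Mod N)" "N #>\<^bsub>G\<^esub> a \<noteq> \<one>\<^bsub>G Mod N\<^esub>"
      using residually_finite_quotient[OF assms(1) ab(2)] by metis
    have "(#>\<^bsub>G\<^esub>) N \<circ> fst \<in> hom (G \<times>\<times> K) (G Mod N)"
      using N(3) by (auto simp: hom_def)
    then show ?thesis
      using finite_index_kernel[OF D N(1,2) _ g(1)] N(4) ab by auto
  next
    case True
    then have "b \<noteq> \<one>\<^bsub>K\<^esub>" using g ab by simp
    then obtain N where N: "group (K Mod N)" "finite (carrier (K Mod N))"
      "(#>\<^bsub>K\<^esub>) N \<in> hom K (K Mod N)" "N #>\<^bsub>K\<^esub> b \<noteq> \<one>\<^bsub>K Mod N\<^esub>"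
      using residually_finite_quotient[OF assms(2) ab(3)] by metis
    have "(#>\<^bsub>K\<^esub>) N \<circ> snd \<in> hom (G \<times>\<times> K) (K Mod N)"
      using N(3) by (auto simp: hom_def)
    then show ?thesis
      using finite_index_kernel[OF D N(1,2) _ g(1)] N(4) ab by auto
  qed
qed

lemma residually_finite_integer_group: "residually_finite integer_group"
  unfolding residually_finite_def
proof (intro conjI ballI impI)
  fix g assume g: "g \<in> carrier integer_group" "g \<noteq> \<one>\<^bsub>integer_group\<^esub>"
  \<comment> \<open>Any modulus larger than \<open>\<bar>g\<bar>\<close> keeps the nonzero
    \<open>g\<close> nonzero.\<close>
  define m where "m = nat (\<bar>g\<bar> + 1)"
  have m: "int m = \<bar>g\<bar> + 1" "m \<noteq> 0" by (auto simp: m_def)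
  have h: "(\<lambda>k. k mod int m) \<in> hom integer_group (integer_mod_group m)"
    using m pos_mod_bound[of "int m"]
    by (auto simp: hom_def carrier_integer_mod_group mod_add_eq simp del: pos_mod_bound)
  have "g mod int m \<noteq> 0"
  proof
    assume "g mod int m = 0"
    then have "int m dvd g" by (rule mod_0_imp_dvd)
    then show False using zdvd_imp_le[of "int m" "\<bar>g\<bar>"] g m by simp
  qed
  then show "\<exists>N. N \<lhd> integer_group \<and> finite (carrier (integer_group Mod N)) \<and> g \<notin> N"
    using finite_index_kernel[OF _ _ _ h g(1)] m by (simp add: carrier_integer_mod_group)
qed simp

section \<open>Free products of families of groups\<close>

definition family_letters :: "('j \<Rightarrow> ('g, 'c) monoid_scheme) \<Rightarrow> ('j \<times> 'g) set"
  where "family_letters G = (SIGMA j:UNIV. carrier (G j))"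

definition family_rels ::
    "('j \<Rightarrow> ('g, 'c) monoid_scheme) \<Rightarrow> (('j \<times> 'g) list \<times> ('j \<times> 'g) list) set"
  where "family_rels G =
      {([(j, a), (j, b)], [(j, a \<otimes>\<^bsub>G j\<^esub> b)]) | j a b. a \<in> carrier (G j) \<and> b \<in> carrier (G j)}
    \<union> {([(j, \<one>\<^bsub>G j\<^esub>)], []) | j. True}"

definition family_product :: "('j \<Rightarrow> ('g, 'c) monoid_scheme) \<Rightarrow> ('j \<times> 'g) list set monoid"
  where "family_product G = word_monoid (family_letters G) (family_rels G)"

definition family_inj :: "('j \<Rightarrow> ('g, 'c) monoid_scheme) \<Rightarrow> 'j \<Rightarrow> 'g \<Rightarrow> ('j \<times> 'g) list set"
  where "family_inj G j a = word_class (family_letters G) (family_rels G) [(j, a)]"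

lemma family_letters_iff [simp]: "(j, a) \<in> family_letters G \<longleftrightarrow> a \<in> carrier (G j)"
  by (simp add: family_letters_def)

lemma family_cong_mult:
  assumes "monoid (G j)" "a \<in> carrier (G j)" "b \<in> carrier (G j)"
  shows "([(j, a), (j, b)], [(j, a \<otimes>\<^bsub>G j\<^esub> b)]) \<in> word_cong (family_letters G) (family_rels G)"
  using word_cong.rel[of "[(j, a), (j, b)]" "[(j, a \<otimes>\<^bsub>G j\<^esub> b)]" "family_rels G"
      "family_letters G" "[]" "[]"] assms
  by (auto simp: family_rels_def monoid.m_closed)

lemma family_cong_one:
  assumes "monoid (G j)"
  shows "([(j, \<one>\<^bsub>G j\<^esub>)], []) \<in> word_cong (family_letters G) (family_rels G)"
  using word_cong.rel[of "[(j, \<one>\<^bsub>G j\<^esub>)]" "[]" "family_rels G"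
      "family_letters G" "[]" "[]"] assms
  by (auto simp: family_rels_def monoid.one_closed)

lemma group_family_product:
  assumes "\<And>j. group (G j)"
  shows "group (family_product G)"
  unfolding family_product_def
proof (rule group_word_monoid)
  fix x assume "x \<in> family_letters G"
  then obtain j a where x: "x = (j, a)" "a \<in> carrier (G j)" by (cases x) auto
  interpret group "G j" by (rule assms)
  have "([(j, inv\<^bsub>G j\<^esub> a), (j, a)], []) \<in> word_cong (family_letters G) (family_rels G)"
    using word_cong.trans[OF family_cong_mult[of G j "inv\<^bsub>G j\<^esub> a" a]] family_cong_one[of G j]
      x by (simp add: monoid_axioms)
  then show "\<exists>b\<in>family_letters G. ([b, x], []) \<in> word_cong (family_letters G) (family_rels G)"
    using x by (intro bexI[of _ "(j, inv\<^bsub>G j\<^esub> a)"]) auto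
qed

lemma family_inj_hom:
  assumes "monoid (G j)"
  shows "family_inj G j \<in> hom (G j) (family_product G)"
proof (rule homI)
  interpret monoid "G j" by fact
  fix a b assume ab: "a \<in> carrier (G j)"
  then show "family_inj G j a \<in> carrier (family_product G)"
    by (auto simp: family_inj_def family_product_def carrier_word_monoid)
  assume "b \<in> carrier (G j)"
  then show "family_inj G j (a \<otimes>\<^bsub>G j\<^esub> b) = family_inj G j a \<otimes>\<^bsub>family_product G\<^esub> family_inj G j b"
    using ab family_cong_mult[of G j a b] assms
    by (auto simp: family_inj_def family_product_def mult_word_monoid word_class_eq_iff
        intro: word_cong.sym)
qed

lemma family_product_hom_exists:
  assumes "group L" and f: "\<And>j. f j \<in> hom (G j) L" and "\<And>j. group (G j)"
  shows "\<exists>h\<in>hom (family_product G) L. \<forall>j. \<forall>a\<in>carrier (G j). h (family_inj G j a) = f j a"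
proof -
  interpret L: group L by fact
  have one: "f j \<one>\<^bsub>G j\<^esub> = \<one>\<^bsub>L\<^esub>" for j
    using assms by (auto intro: hom_one)
  have closed: "f j a \<in> carrier L" if "a \<in> carrier (G j)" for j a
    using f[of j] that by (auto simp: hom_def)
  have "\<exists>h\<in>hom (family_product G) L. \<forall>x\<in>family_letters G.
      h (word_class (family_letters G) (family_rels G) [x]) = (case x of (j, a) \<Rightarrow> f j a)"
    unfolding family_product_def
    by (rule word_monoid_hom_exists)
       (auto simp: L.monoid_axioms closed one family_rels_def L.m_assoc hom_mult[OF f])
  then obtain h where "h \<in> hom (family_product G) L"
    "\<And>j a. a \<in> carrier (G j) \<Longrightarrow> h (family_inj G j a) = f j a"
    unfolding family_inj_def by (metis (mono_tags, lifting) case_prod_conv family_letters_iff)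
  then show ?thesis by blast
qed

section \<open>Reduced words and their permutation actions\<close>

fun reduced_word :: "('j \<Rightarrow> ('g, 'c) monoid_scheme) \<Rightarrow> ('j \<times> 'g) list \<Rightarrow> bool" where
  "reduced_word G [] \<longleftrightarrow> True"
| "reduced_word G ((j, a) # w) \<longleftrightarrow>
    a \<in> carrier (G j) \<and> a \<noteq> \<one>\<^bsub>G j\<^esub> \<and> (w = [] \<or> fst (hd w) \<noteq> j) \<and> reduced_word G w"

lemma reduced_word_lists: "reduced_word G w \<Longrightarrow> w \<in> lists (family_letters G)"
  by (induction G w rule: reduced_word.induct) auto

text \<open>A letter put in front of a reduced word is trivial, opens a new syllable, or merges with
  the first syllable. If the merged syllable is trivial, dropping it leaves a tail of a reduced
  word, which is reduced.\<close>

lemma reduced_word_exists: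
  assumes "\<And>j. group (G j)" "u \<in> lists (family_letters G)"
  shows "\<exists>v. reduced_word G v \<and> (u, v) \<in> word_cong (family_letters G) (family_rels G)"
  using assms(2)
proof (induction u)
  case Nil
  show ?case by (rule exI[of _ "[]"]) (simp add: word_cong.refl)
next
  case (Cons x u)
  let ?C = "word_cong (family_letters G) (family_rels G)"
  obtain j a where x: "x = (j, a)" by (cases x)
  then have a: "a \<in> carrier (G j)" using Cons by auto
  interpret group "G j" by (rule assms)
  obtain v where v: "reduced_word G v" "(u, v) \<in> ?C" using Cons by auto
  have vl: "v \<in> lists (family_letters G)" using v by (simp add: reduced_word_lists)
  have uv: "(x # u, x # v) \<in> ?C"
    using word_cong_append[OF word_cong.refl v(2), of "[x]"] a x by simp
  consider "a = \<one>\<^bsub>G j\<^esub>" | "a \<noteq> \<one>\<^bsub>G j\<^esub>" "v = [] \<or> fst (hd v) \<noteq> j"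
    | b w where "v = (j, b) # w"
    by (metis list.exhaust list.sel(1) prod.exhaust_sel)
  then show ?case
  proof cases
    case 1
    then have "(x # v, v) \<in> ?C"
      using word_cong_append[OF family_cong_one word_cong.refl, of G j v] x vl
      by (simp add: monoid_axioms)
    then show ?thesis using v(1) word_cong.trans[OF uv] by blast
  next
    case 2
    then have "reduced_word G (x # v)" using a v x by simp
    then show ?thesis using uv by blast
  next
    case (3 b w)
    have bw: "b \<in> carrier (G j)" "w \<in> lists (family_letters G)" "reduced_word G w"
      "w = [] \<or> fst (hd w) \<noteq> j"
      using 3 v(1) vl by auto
    have c: "(x # v, (j, a \<otimes>\<^bsub>G j\<^esub> b) # w) \<in> ?C"
      using word_cong_append[OF family_cong_mult word_cong.refl, of G j a b w] x a bw 3
      by (simp add: monoid_axioms)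
    show ?thesis
    proof (cases "a \<otimes>\<^bsub>G j\<^esub> b = \<one>\<^bsub>G j\<^esub>")
      case True
      then have "((j, a \<otimes>\<^bsub>G j\<^esub> b) # w, w) \<in> ?C"
        using word_cong_append[OF family_cong_one word_cong.refl, of G j w] bw
        by (simp add: monoid_axioms)
      then show ?thesis using bw(3) word_cong.trans[OF word_cong.trans[OF uv c]] by blast
    next
      case False
      then have "reduced_word G ((j, a \<otimes>\<^bsub>G j\<^esub> b) # w)" using a bw by simp
      then show ?thesis using word_cong.trans[OF uv c] by blast
    qed
  qed
qed

text \<open>The points form a chain of coset spaces \<open>G j / N\<close>, one for each syllable, in which the
  path traced by the word leaves its starting point for good. A new syllable \<open>(j, a)\<close> glues one more
  coset space to the end of the path, where the action of \<open>G j\<close> was trivial so far.\<close>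

lemma reduced_word_action:
  assumes "\<And>j. residually_finite (G j)" "reduced_word G w"
  shows "\<exists>m \<sigma> p q. (\<forall>j. \<sigma> j \<in> hom (G j) (sym_group m)) \<and> p \<in> {1..m} \<and> q \<in> {1..m} \<and>
    foldr (\<lambda>(j, a). \<sigma> j a) w q = p \<and>
    (\<forall>u v. w = u @ v \<longrightarrow> u \<noteq> [] \<longrightarrow> foldr (\<lambda>(j, a). \<sigma> j a) v q \<noteq> p) \<and>
    (\<forall>j. w = [] \<or> fst (hd w) \<noteq> j \<longrightarrow> (\<forall>a\<in>carrier (G j). \<sigma> j a p = p))"
  using assms(2)
proof (induction w)
  case Nil
  have h: "\<forall>j. (\<lambda>_. id) \<in> hom (G j) (sym_group 1)"
    by (auto simp: hom_def sym_group_def permutes_id)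
  show ?case
    by (rule exI[of _ 1], rule exI[of _ "\<lambda>_ _. id"], rule exI[of _ 1], rule exI[of _ 1],
        rule conjI[OF h]) simp
next
  case (Cons x w)
  obtain j a where x: "x = (j, a)" by (cases x)
  interpret group "G j" using assms by (simp add: residually_finite_def)
  have ja: "a \<in> carrier (G j)" "a \<noteq> \<one>\<^bsub>G j\<^esub>" "w = [] \<or> fst (hd w) \<noteq> j" "reduced_word G w"
    using Cons.prems x by auto
  obtain m \<sigma> p q where IH: "\<And>j. \<sigma> j \<in> hom (G j) (sym_group m)" "p \<in> {1..m}" "q \<in> {1..m}"
    "foldr (\<lambda>(j, a). \<sigma> j a) w q = p"
    "\<And>u v. w = u @ v \<Longrightarrow> u \<noteq> [] \<Longrightarrow> foldr (\<lambda>(j, a). \<sigma> j a) v q \<noteq> p"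
    "\<And>j a. w = [] \<or> fst (hd w) \<noteq> j \<Longrightarrow> a \<in> carrier (G j) \<Longrightarrow> \<sigma> j a p = p"
    using Cons.IH[OF ja(4)] by metis
  have perm: "\<sigma> k b permutes {1..m}" if "b \<in> carrier (G k)" for k b
    using IH(1)[of k] that by (auto simp: hom_def sym_group_def)
  have \<sigma>m: "\<sigma> k (b \<otimes>\<^bsub>G k\<^esub> c) i = \<sigma> k b (\<sigma> k c i)"
    if "b \<in> carrier (G k)" "c \<in> carrier (G k)" for k b c i
    using IH(1)[of k] that by (auto simp: hom_def sym_group_def)
  obtain N where N: "N \<lhd> G j" "finite (carrier (G j Mod N))" "N #>\<^bsub>G j\<^esub> a \<noteq> \<one>\<^bsub>G j Mod N\<^esub>"
    "(#>\<^bsub>G j\<^esub>) N \<in> hom (G j) (G j Mod N)" "group (G j Mod N)"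
    using residually_finite_quotient[OF assms(1) ja(1,2)] by metis
  define Q where "Q = G j Mod N"
  interpret Q: group Q using N(5) by (simp add: Q_def)
  let ?\<pi> = "\<lambda>b. N #>\<^bsub>G j\<^esub> b"
  have \<pi>: "?\<pi> b \<in> carrier Q" "c \<in> carrier (G j) \<Longrightarrow> ?\<pi> (b \<otimes>\<^bsub>G j\<^esub> c) = ?\<pi> b \<otimes>\<^bsub>Q\<^esub> ?\<pi> c"
    if "b \<in> carrier (G j)" for b c
    using N(4) that by (auto simp: hom_def Q_def)
  have finQ: "finite (carrier Q)" using N(2) by (simp add: Q_def)
  \<comment> \<open>The trivial coset will be identified with the old end point \<open>p\<close>, so
    only the nontrivial cosets need new points.\<close>
  define M where "M = m + card (carrier Q - {\<one>\<^bsub>Q\<^esub>})"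
  have "finite (carrier Q - {\<one>\<^bsub>Q\<^esub>})" "card (carrier Q - {\<one>\<^bsub>Q\<^esub>}) = card {m+1..M}"
    using finQ by (simp_all add: M_def)
  from finite_same_card_bij[OF this(1) finite_atLeastAtMost this(2)]
  obtain \<beta>0 where \<beta>0: "bij_betw \<beta>0 (carrier Q - {\<one>\<^bsub>Q\<^esub>}) {m+1..M}"
    by blast
  define \<beta> where "\<beta> y = (if y = \<one>\<^bsub>Q\<^esub> then p else \<beta>0 y)" for y
  have \<beta>new: "\<beta> y \<in> {m+1..M}" if "y \<in> carrier Q" "y \<noteq> \<one>\<^bsub>Q\<^esub>" for y
    using \<beta>0 that by (auto simp: \<beta>_def bij_betw_def)
  have "\<beta> ` (carrier Q - {\<one>\<^bsub>Q\<^esub>}) = \<beta>0 ` (carrier Q - {\<one>\<^bsub>Q\<^esub>})"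
    by (rule image_cong) (auto simp: \<beta>_def)
  also have "\<dots> = {m+1..M}" using \<beta>0 by (rule bij_betw_imp_surj_on)
  finally have "\<beta> ` insert \<one>\<^bsub>Q\<^esub> (carrier Q - {\<one>\<^bsub>Q\<^esub>}) = insert p {m+1..M}"
    by (simp only: image_insert) (simp add: \<beta>_def)
  then have \<beta>img: "\<beta> ` carrier Q = insert p {m+1..M}"
    by (simp add: insert_absorb)
  have \<beta>inj: "inj_on \<beta> (carrier Q)"
  proof (rule inj_onI)
    fix y z assume yz: "y \<in> carrier Q" "z \<in> carrier Q" "\<beta> y = \<beta> z"
    have "p \<notin> {m+1..M}" using IH(2) by auto
    then have "y = \<one>\<^bsub>Q\<^esub> \<longleftrightarrow> z = \<one>\<^bsub>Q\<^esub>"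
      using \<beta>new[of y] \<beta>new[of z] yz by (metis \<beta>_def)
    then show "y = z" using yz \<beta>0 by (auto simp: \<beta>_def bij_betw_def inj_on_def split: if_splits)
  qed
  define B where "B = insert p {m+1..M}"
  define \<gamma> where "\<gamma> = the_inv_into (carrier Q) \<beta>"
  have \<gamma>: "\<gamma> (\<beta> y) = y" if "y \<in> carrier Q" for y
    using that \<beta>inj by (simp add: \<gamma>_def the_inv_into_f_f)
  have \<gamma>c: "\<gamma> i \<in> carrier Q" "\<beta> (\<gamma> i) = i" if "i \<in> B" for i
    using that \<beta>img \<beta>inj by (auto simp: \<gamma>_def B_def the_inv_into_into f_the_inv_into_f)
  have \<beta>B: "\<beta> y \<in> B" if "y \<in> carrier Q" for y
    using that \<beta>img B_def by blast
  \<comment> \<open>On the glued coset space \<open>B\<close> the group acts by left multiplication,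
    elsewhere as before.\<close>
  define \<tau> where "\<tau> b i = (if i \<in> B then \<beta> (?\<pi> b \<otimes>\<^bsub>Q\<^esub> \<gamma> i) else \<sigma> j b i)" for b i
  have fixp: "\<sigma> j b p = p" if "b \<in> carrier (G j)" for b
    using IH(6)[OF ja(3)] that by blast
  \<comment> \<open>The old action fixes \<open>B\<close> pointwise: it fixes \<open>p\<close> since
    \<open>w\<close> does not start with a syllable from \<open>j\<close>, and it does not move
    points above \<open>m\<close>.\<close>
  have \<sigma>B: "\<sigma> j b i \<in> B \<longleftrightarrow> i \<in> B" if "b \<in> carrier (G j)" for b i
  proof -
    have "\<sigma> j b i = i" if "i \<in> B"
      using fixp perm \<open>b \<in> carrier (G j)\<close> that permutes_not_in[of "\<sigma> j b" "{1..m}" i]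
      by (auto simp: B_def)
    moreover have "i = \<sigma> j b i" if "\<sigma> j b i \<in> B"
    proof -
      have "\<sigma> j b (\<sigma> j b i) = \<sigma> j b i"
        using fixp perm[OF \<open>b \<in> carrier (G j)\<close>] \<open>b \<in> carrier (G j)\<close> that
          permutes_not_in[of "\<sigma> j b" "{1..m}" "\<sigma> j b i"]
        by (auto simp: B_def)
      then show ?thesis
        using permutes_inj[OF perm[OF \<open>b \<in> carrier (G j)\<close>]] by (metis injD)
    qed
    ultimately show ?thesis by metis
  qed
  have \<tau>m: "\<tau> (b \<otimes>\<^bsub>G j\<^esub> c) i = \<tau> b (\<tau> c i)"
    if bc: "b \<in> carrier (G j)" "c \<in> carrier (G j)" for b c i
  proof (cases "i \<in> B")
    case True
    then show ?thesis
      using bc by (simp add: \<tau>_def \<beta>B \<gamma> \<gamma>c \<pi> Q.m_assoc)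
  qed (use bc in \<open>simp add: \<tau>_def \<sigma>B \<sigma>m\<close>)
  have \<pi>1: "?\<pi> \<one>\<^bsub>G j\<^esub> = \<one>\<^bsub>Q\<^esub>"
    using hom_one[OF N(4) group_axioms N(5)] by (simp add: Q_def)
  have \<tau>1: "\<tau> \<one>\<^bsub>G j\<^esub> i = i" for i
  proof (cases "i \<in> B")
    case False
    have "\<sigma> j \<one>\<^bsub>G j\<^esub> = id"
      using hom_one[OF IH(1) group_axioms sym_group_is_group] by (simp add: sym_group_def)
    then show ?thesis using False by (simp add: \<tau>_def)
  qed (simp add: \<tau>_def \<pi>1 \<gamma>c)
  have \<tau>perm: "\<tau> b permutes {1..M}" if b: "b \<in> carrier (G j)" for b
  proof -
    have "bij (\<tau> b)"
      using \<tau>m[of b "inv\<^bsub>G j\<^esub> b"] \<tau>m[of "inv\<^bsub>G j\<^esub> b" b] \<tau>1 b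
      by (intro o_bij[of "\<tau> (inv\<^bsub>G j\<^esub> b)"]) (auto simp: fun_eq_iff)
    moreover have "\<tau> b i = i" if "i \<notin> {1..M}" for i
    proof -
      have "i \<notin> B" "i \<notin> {1..m}" using that IH(2) by (auto simp: B_def M_def)
      then show ?thesis using permutes_not_in[OF perm[OF b]] by (auto simp: \<tau>_def)
    qed
    ultimately show ?thesis by (simp add: permutes_def bij_iff)
  qed
  define \<sigma>' where "\<sigma>' k = (if k = j then \<tau> else \<sigma> k)" for k
  have h': "\<sigma>' k \<in> hom (G k) (sym_group M)" for k
  proof (cases "k = j")
    case True
    then show ?thesis using \<tau>m \<tau>perm by (auto simp: hom_def sym_group_def \<sigma>'_def)
  next
    case False
    have "\<sigma> k b permutes {1..M}" if "b \<in> carrier (G k)" for b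
      using perm[OF that] by (rule permutes_subset) (auto simp: M_def)
    then show ?thesis using False \<sigma>m by (auto simp: hom_def sym_group_def \<sigma>'_def)
  qed
  define p' where "p' = \<beta> (?\<pi> a)"
  have p'new: "p' \<in> {m+1..M}"
    using \<beta>new[of "?\<pi> a"] \<pi>(1)[OF ja(1)] N(3) by (simp add: p'_def Q_def)
  have \<gamma>p: "\<gamma> p = \<one>\<^bsub>Q\<^esub>" using \<gamma>[of "\<one>\<^bsub>Q\<^esub>"] by (simp add: \<beta>_def)
  \<comment> \<open>Old and new actions differ only on \<open>B\<close>, and on the way to
    \<open>p\<close> the path of \<open>w\<close> meets no point of \<open>B\<close>; this is why
    the induction carries the clause about proper suffixes.\<close>
  have same: "foldr (\<lambda>(j, a). \<sigma>' j a) v q = foldr (\<lambda>(j, a). \<sigma> j a) v q \<and>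
      foldr (\<lambda>(j, a). \<sigma> j a) v q \<in> {1..m}" if "w = u @ v" for u v
    using that
  proof (induction v arbitrary: u)
    case Nil
    then show ?case using IH(3) by simp
  next
    case (Cons y v)
    obtain k b where y: "y = (k, b)" by (cases y)
    have b: "b \<in> carrier (G k)"
      using reduced_word_lists[OF ja(4)] Cons.prems y by auto
    let ?i = "foldr (\<lambda>(j, a). \<sigma> j a) v q"
    have i: "?i \<in> {1..m}" "?i \<noteq> p" "foldr (\<lambda>(j, a). \<sigma>' j a) v q = ?i"
      using Cons.IH[of "u @ [y]"] IH(5)[of "u @ [y]" v] Cons.prems by auto
    then have "?i \<notin> B" by (auto simp: B_def)
    then have "\<sigma>' k b ?i = \<sigma> k b ?i" by (simp add: \<sigma>'_def \<tau>_def)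
    moreover have "\<sigma> k b ?i \<in> {1..m}" using i(1) permutes_in_image[OF perm[OF b]] by blast
    ultimately show ?case using i(3) y by simp
  qed
  have "\<sigma>' j a p = p'"
    using \<gamma>p \<pi>(1)[OF ja(1)] by (simp add: \<sigma>'_def \<tau>_def B_def p'_def)
  then have "foldr (\<lambda>(j, a). \<sigma>' j a) (x # w) q = p'"
    using same[of "[]" w] IH(4) x by simp
  moreover have "foldr (\<lambda>(j, a). \<sigma>' j a) v q \<noteq> p'" if uv: "x # w = u @ v" "u \<noteq> []" for u v
  proof -
    obtain u' where "w = u' @ v" using uv by (cases u) auto
    then show ?thesis using same[of u' v] p'new by auto
  qed
  moreover have "\<sigma>' k b p' = p'" if "k \<noteq> j" "b \<in> carrier (G k)" for k b
    using that permutes_not_in[OF perm[OF that(2)], of p'] p'new by (auto simp: \<sigma>'_def)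
  moreover have "q \<in> {1..M}" "p' \<in> {1..M}" using IH(3) p'new by (auto simp: M_def)
  ultimately show ?case
    using h' x by (intro exI[of _ M] exI[of _ \<sigma>'] exI[of _ p'] exI[of _ q]) auto
qed

text \<open>A nontrivial element has a nonempty reduced word, and such a word acts nontrivially on a
  finite set.\<close>

lemma residually_finite_family_product:
  assumes "\<And>j. residually_finite (G j)"
  shows "residually_finite (family_product G)"
  unfolding residually_finite_def
proof (intro conjI ballI impI)
  have G: "group (G j)" for j using assms by (simp add: residually_finite_def)
  let ?K = "family_product G"
  show K: "group ?K" using group_family_product G .
  fix g assume g: "g \<in> carrier ?K" "g \<noteq> \<one>\<^bsub>?K\<^esub>"
  let ?cl = "word_class (family_letters G) (family_rels G)"
  obtain u where u: "u \<in> lists (family_letters G)" "g = ?cl u"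
    using g(1) by (auto simp: family_product_def carrier_word_monoid)
  obtain w where w: "reduced_word G w" "(u, w) \<in> word_cong (family_letters G) (family_rels G)"
    using reduced_word_exists[OF G u(1)] by blast
  have wl: "w \<in> lists (family_letters G)" using w(1) by (rule reduced_word_lists)
  have gw: "g = ?cl w" using w(2) u wl by (simp add: word_class_eq_iff)
  have "w \<noteq> []" using g(2) gw by (auto simp: family_product_def one_word_monoid)
  \<comment> \<open>The empty suffix in the path clause says that the end point differs from the
    starting point \<open>q\<close>.\<close>
  then obtain m \<sigma> q where \<sigma>: "\<And>j. \<sigma> j \<in> hom (G j) (sym_group m)"
    "foldr (\<lambda>(j, a). \<sigma> j a) w q \<noteq> q"
    using reduced_word_action[of G w, OF assms w(1)] by (metis append_Nil2 foldr.simps(1) id_apply)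
  obtain h where h: "h \<in> hom ?K (sym_group m)" "\<And>j a. a \<in> carrier (G j) \<Longrightarrow> h (family_inj G j a) = \<sigma> j a"
    using family_product_hom_exists[of "sym_group m" \<sigma> G, OF sym_group_is_group \<sigma>(1) G] by blast
  have "h (?cl v) i = foldr (\<lambda>(j, a). \<sigma> j a) v i" if "v \<in> lists (family_letters G)" for v i
    using that
  proof (induction v)
    case Nil
    have "h \<one>\<^bsub>?K\<^esub> = id"
      using hom_one[OF h(1) K sym_group_is_group] by (simp add: sym_group_def)
    then show ?case by (simp add: family_product_def one_word_monoid)
  next
    case (Cons x v)
    obtain j a where x: "x = (j, a)" by (cases x)
    have "?cl (x # v) = family_inj G j a \<otimes>\<^bsub>?K\<^esub> ?cl v"
      using Cons.hyps mult_word_monoid[of "[x]" _ v] x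
      by (simp add: family_inj_def family_product_def)
    moreover have "family_inj G j a \<in> carrier ?K" "?cl v \<in> carrier ?K"
      using Cons.hyps x by (auto simp: family_inj_def family_product_def carrier_word_monoid)
    ultimately have "h (?cl (x # v)) = h (family_inj G j a) \<circ> h (?cl v)"
      using hom_mult[OF h(1)] by (simp add: sym_group_def)
    then show ?case using Cons x h(2) by auto
  qed
  then have "h g \<noteq> \<one>\<^bsub>sym_group m\<^esub>"
    using \<sigma>(2) gw wl by (metis id_apply sym_group_one)
  moreover have "finite (carrier (sym_group m))"
    by (simp add: sym_group_def finite_permutations)
  ultimately show "\<exists>N. N \<lhd> ?K \<and> finite (carrier (?K Mod N)) \<and> g \<notin> N"
    using finite_index_kernel[OF K sym_group_is_group _ h(1) g(1)] by blast
qed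

section \<open>Labellings of the integers\<close>

lemma ambient_generators [simp]:
  assumes "group H"
  shows "h \<in> carrier H \<Longrightarrow> free_product_inl H (free_group Xs) h \<in> carrier (ambient_group Xs H)"
    and "x \<in> Xs \<Longrightarrow> free_product_inr H (free_group Xs) (free_gen Xs x) \<in> carrier (ambient_group Xs H)"
proof -
  assume "h \<in> carrier H"
  then show "free_product_inl H (free_group Xs) h \<in> carrier (ambient_group Xs H)"
    using free_product_inl_hom[OF group.is_monoid[OF assms], of "free_group Xs"]
    by (auto simp: hom_def)
next
  assume "x \<in> Xs"
  then show "free_product_inr H (free_group Xs) (free_gen Xs x) \<in> carrier (ambient_group Xs H)"
    using free_product_inr_hom[OF group.is_monoid[OF group_free_group], of H Xs]
      free_gen_closed[of x Xs] by (auto simp: hom_def)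
qed

lemma ambient_hom_exists:
  assumes "group H" "group L" "f \<in> hom H L" "\<And>x. x \<in> Xs \<Longrightarrow> y x \<in> carrier L"
  obtains \<Psi> where "\<Psi> \<in> hom (ambient_group Xs H) L"
    "\<And>h. h \<in> carrier H \<Longrightarrow> \<Psi> (free_product_inl H (free_group Xs) h) = f h"
    "\<And>x. x \<in> Xs \<Longrightarrow> \<Psi> (free_product_inr H (free_group Xs) (free_gen Xs x)) = y x"
proof -
  obtain k where k: "k \<in> hom (free_group Xs) L" "\<forall>x\<in>Xs. k (free_gen Xs x) = y x"
    using free_group_hom_exists[OF assms(2), of Xs y] assms(4) by blast
  then show ?thesis
    using free_product_hom_exists[OF assms(1) group_free_group assms(2,3) k(1)] that
    by (metis free_gen_closed)
qed

text \<open>Elements are words over \<open>H\<close> and the free group, whose elements are in turn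
  classes of words, so the induction unfolds two levels.\<close>

lemma ambient_induct [consumes 2, case_names one inl gen inv_gen]:
  assumes "group H" "g \<in> carrier (ambient_group Xs H)"
    and one: "P \<one>\<^bsub>ambient_group Xs H\<^esub>"
    and inl: "\<And>h g. h \<in> carrier H \<Longrightarrow> g \<in> carrier (ambient_group Xs H) \<Longrightarrow> P g \<Longrightarrow>
      P (free_product_inl H (free_group Xs) h \<otimes>\<^bsub>ambient_group Xs H\<^esub> g)"
    and gen: "\<And>x g. x \<in> Xs \<Longrightarrow> g \<in> carrier (ambient_group Xs H) \<Longrightarrow> P g \<Longrightarrow>
      P (free_product_inr H (free_group Xs) (free_gen Xs x) \<otimes>\<^bsub>ambient_group Xs H\<^esub> g)"
    and inv_gen: "\<And>x g. x \<in> Xs \<Longrightarrow> g \<in> carrier (ambient_group Xs H) \<Longrightarrow> P g \<Longrightarrow>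
      P (inv\<^bsub>ambient_group Xs H\<^esub> free_product_inr H (free_group Xs) (free_gen Xs x)
        \<otimes>\<^bsub>ambient_group Xs H\<^esub> g)"
  shows "P g"
proof -
  let ?A = "ambient_group Xs H" and ?F = "free_group Xs"
  let ?cf = "word_class (Xs \<times> UNIV) (free_group_rels Xs)"
  let ?ca = "word_class (carrier H <+> carrier ?F) (free_product_rels H ?F)"
  interpret A: group ?A by (rule group_ambient_group) fact
  interpret F: group ?F by (rule group_free_group)
  have inr: "free_product_inr H ?F \<in> hom ?F ?A"
    by (rule free_product_inr_hom) (rule F.is_monoid)
  interpret inr: group_hom ?F ?A "free_product_inr H ?F"
    using inr by unfold_locales
  have invg: "?cf [(x, False)] = inv\<^bsub>?F\<^esub> free_gen Xs x" if "x \<in> Xs" for x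
  proof (rule F.inv_equality[symmetric])
    have "([(x, False), (x, \<not> False)], []) \<in> free_group_rels Xs"
      unfolding free_group_rels_def using that by blast
    from word_cong.rel[OF this, of "Xs \<times> UNIV" "[]" "[]"]
    have "([(x, False), (x, True)], []) \<in> word_cong (Xs \<times> UNIV) (free_group_rels Xs)"
      using that by simp
    then show "?cf [(x, False)] \<otimes>\<^bsub>?F\<^esub> free_gen Xs x = \<one>\<^bsub>?F\<^esub>"
      using that
      by (simp add: free_gen_def free_group_def mult_word_monoid one_word_monoid word_class_eq_iff)
    show "?cf [(x, False)] \<in> carrier ?F"
      using that by (auto simp: free_group_def carrier_word_monoid)
  qed (rule free_gen_closed[OF that])
  have free: "P (free_product_inr H ?F (?cf v) \<otimes>\<^bsub>?A\<^esub> g)"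
    if "v \<in> lists (Xs \<times> UNIV)" "g \<in> carrier ?A" "P g" for v g
    using that(1)
  proof (induction v)
    case Nil
    have "?cf [] = \<one>\<^bsub>?F\<^esub>" by (simp add: free_group_def one_word_monoid)
    then show ?case using that by simp
  next
    case (Cons c v)
    obtain x b where c: "c = (x, b)" by (cases c)
    have x: "x \<in> Xs" using Cons.hyps c by auto
    let ?k = "?cf [c]"
    have v: "?cf v \<in> carrier ?F" "?k \<in> carrier ?F"
      using Cons.hyps by (auto simp: free_group_def carrier_word_monoid)
    have "?cf (c # v) = ?k \<otimes>\<^bsub>?F\<^esub> ?cf v"
      using Cons.hyps mult_word_monoid[of "[c]" _ v] by (simp add: free_group_def)
    then have e: "free_product_inr H ?F (?cf (c # v)) \<otimes>\<^bsub>?A\<^esub> g =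
        free_product_inr H ?F ?k \<otimes>\<^bsub>?A\<^esub> (free_product_inr H ?F (?cf v) \<otimes>\<^bsub>?A\<^esub> g)"
      using v that by (simp add: A.m_assoc)
    have ih: "free_product_inr H ?F (?cf v) \<otimes>\<^bsub>?A\<^esub> g \<in> carrier ?A"
      "P (free_product_inr H ?F (?cf v) \<otimes>\<^bsub>?A\<^esub> g)"
      using Cons.IH v that by simp_all
    show ?case
    proof (cases b)
      case True
      then have "?k = free_gen Xs x" using c by (simp add: free_gen_def)
      then show ?thesis using e gen[OF x ih] by simp
    next
      case False
      then have "?k = inv\<^bsub>?F\<^esub> free_gen Xs x" using c invg[OF x] by simp
      then show ?thesis using e inv_gen[OF x ih] by (simp add: free_gen_closed[OF x])
    qed
  qed
  obtain u where u: "u \<in> lists (carrier H <+> carrier ?F)" "g = ?ca u"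
    using assms(2) by (auto simp: free_product_def carrier_word_monoid)
  have "P (?ca u)" using u(1)
  proof (induction u)
    case Nil
    then show ?case using one by (simp add: free_product_def one_word_monoid)
  next
    case (Cons c u)
    have u: "?ca u \<in> carrier ?A"
      using Cons.hyps by (auto simp: free_product_def carrier_word_monoid)
    have e: "?ca (c # u) = ?ca [c] \<otimes>\<^bsub>?A\<^esub> ?ca u"
      using Cons.hyps mult_word_monoid[of "[c]" _ u] by (simp add: free_product_def)
    show ?case
    proof (cases c)
      case (Inl h)
      then show ?thesis using e inl[of h "?ca u"] Cons u by (auto simp: free_product_inl_def)
    next
      case (Inr k)
      then have "k \<in> carrier ?F" using Cons.hyps by auto
      then obtain v where "v \<in> lists (Xs \<times> UNIV)" "k = ?cf v"
        by (auto simp: free_group_def carrier_word_monoid)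
      then show ?thesis using e free[OF _ u Cons.IH] Inr by (simp add: free_product_inr_def)
    qed
  qed
  then show ?thesis using u by simp
qed

section \<open>Wreath products and labelled paths\<close>

text \<open>The wreath product of \<open>P\<close> with \<open>\<int> / N\<close>, with elements of the base group written as
  \<open>N\<close>-periodic functions on the integers. Since \<open>k mod 0 = k\<close>, the case \<open>N = 0\<close> is the
  unrestricted wreath product with \<open>\<int>\<close>.\<close>

definition shift_wreath :: "('p, 'c) monoid_scheme \<Rightarrow> int \<Rightarrow> ((int \<Rightarrow> 'p) \<times> int) monoid"
  where "shift_wreath P N =
    \<lparr> carrier = {(f, k). (\<forall>i. f i \<in> carrier P \<and> f (i + N) = f i) \<and> k mod N = k},
      monoid.mult = (\<lambda>(f, k) (f', k'). (\<lambda>i. f i \<otimes>\<^bsub>P\<^esub> f' (i + k), (k + k') mod N)),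
      monoid.one = (\<lambda>_. \<one>\<^bsub>P\<^esub>, 0) \<rparr>"

lemma periodic_cong:
  fixes f :: "int \<Rightarrow> 'b"
  assumes "\<And>i. f (i + N) = f i" "i mod N = j mod N"
  shows "f i = f j"
proof -
  have nat: "f (i + int n * N) = f i" for i n
  proof (induction n arbitrary: i)
    case (Suc n)
    have "f (i + int (Suc n) * N) = f ((i + N) + int n * N)" by (simp add: algebra_simps)
    then show ?case using Suc assms(1) by simp
  qed simp
  have int: "f (i + k * N) = f i" for i k
  proof (cases "k \<ge> 0")
    case True
    then show ?thesis using nat[of i "nat k"] by simp
  next
    case False
    then show ?thesis using nat[of "i + k * N" "nat (- k)"] by simp
  qed
  obtain k where "i = j + k * N"
    using assms(2) by (metis add.commute add_diff_cancel_left' diff_add_cancel mod_eqE mult.commute)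
  then show ?thesis using int by simp
qed

lemma periodic_mod:
  fixes f :: "int \<Rightarrow> 'b"
  assumes "\<And>i. f (i + N) = f i"
  shows "f (i + k mod N) = f (i + k)" "f (k mod N + i) = f (k + i)"
  by (rule periodic_cong[of f N, OF assms], simp add: mod_simps)+

lemma group_shift_wreath:
  assumes "group P"
  shows "group (shift_wreath P N)"
proof (rule groupI)
  interpret group P by fact
  let ?W = "shift_wreath P N"
  fix x assume x: "x \<in> carrier ?W"
  obtain f k where fk: "x = (f, k)" "\<And>i. f i \<in> carrier P" "\<And>i. f (i + N) = f i" "k mod N = k"
    using x by (auto simp: shift_wreath_def)
  show "\<one>\<^bsub>?W\<^esub> \<otimes>\<^bsub>?W\<^esub> x = x"
    using fk by (auto simp: shift_wreath_def)
  let ?y = "(\<lambda>i. inv\<^bsub>P\<^esub> f (i - k), (- k) mod N)"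
  have sh: "f (i + N - k) = f (i - k)" for i
    using fk(3)[of "i - k"] by (simp add: algebra_simps)
  have "?y \<in> carrier ?W"
    using fk(2) sh by (auto simp: shift_wreath_def)
  moreover have "?y \<otimes>\<^bsub>?W\<^esub> x = \<one>\<^bsub>?W\<^esub>"
    using fk(2) by (auto simp: shift_wreath_def fk(1) periodic_mod[of f N, OF fk(3)] mod_simps)
  ultimately show "\<exists>y\<in>carrier ?W. y \<otimes>\<^bsub>?W\<^esub> x = \<one>\<^bsub>?W\<^esub>" by blast
  fix x' assume x': "x' \<in> carrier ?W"
  obtain f' k' where fk': "x' = (f', k')" "\<And>i. f' i \<in> carrier P" "\<And>i. f' (i + N) = f' i"
    using x' by (auto simp: shift_wreath_def)
  have sh': "f' (i + N + k) = f' (i + k)" for i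
    using fk'(3)[of "i + k"] by (simp add: algebra_simps)
  show "x \<otimes>\<^bsub>?W\<^esub> x' \<in> carrier ?W"
    using fk fk' sh' by (auto simp: shift_wreath_def)
  fix x'' assume x'': "x'' \<in> carrier ?W"
  obtain f'' k'' where fk'': "x'' = (f'', k'')" "\<And>i. f'' i \<in> carrier P" "\<And>i. f'' (i + N) = f'' i"
    using x'' by (auto simp: shift_wreath_def)
  show "x \<otimes>\<^bsub>?W\<^esub> x' \<otimes>\<^bsub>?W\<^esub> x'' = x \<otimes>\<^bsub>?W\<^esub> (x' \<otimes>\<^bsub>?W\<^esub> x'')"
    using fk fk' fk''
    by (auto simp: shift_wreath_def m_assoc periodic_mod[of f'' N, OF fk''(3)] mod_simps algebra_simps)
next
  interpret group P by fact
  show "\<one>\<^bsub>shift_wreath P N\<^esub> \<in> carrier (shift_wreath P N)"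
    by (auto simp: shift_wreath_def)
qed

lemma finite_shift_wreath:
  assumes "finite (carrier P)" "N > 0"
  shows "finite (carrier (shift_wreath P N))"
proof -
  let ?r = "\<lambda>(f, k). (restrict f {0..<N}, k)"
  have "inj_on ?r (carrier (shift_wreath P N))"
  proof (rule inj_onI)
    fix x y assume *: "x \<in> carrier (shift_wreath P N)" "y \<in> carrier (shift_wreath P N)"
      "?r x = ?r y"
    obtain f k f' k' where xy: "x = (f, k)" "y = (f', k')" by (cases x, cases y)
    have per: "f (i + N) = f i" "f' (i + N) = f' i" for i
      using * xy by (auto simp: shift_wreath_def)
    have r: "restrict f {0..<N} = restrict f' {0..<N}" "k = k'" using * xy by simp_all
    have "f i = f' i" for i
      using fun_cong[OF r(1), of "i mod N"] periodic_mod(2)[of f N i 0, OF per(1)]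
        periodic_mod(2)[of f' N i 0, OF per(2)] assms(2) by simp
    then show "x = y" using xy r(2) by blast
  qed
  moreover have "?r ` carrier (shift_wreath P N) \<subseteq> (PiE {0..<N} (\<lambda>_. carrier P)) \<times> {0..<N}"
  proof (rule image_subsetI)
    fix x assume x: "x \<in> carrier (shift_wreath P N)"
    obtain f k where fk: "x = (f, k)" by (cases x)
    then have "k mod N = k" "\<And>i. f i \<in> carrier P" using x by (simp_all add: shift_wreath_def)
    then show "?r x \<in> (PiE {0..<N} (\<lambda>_. carrier P)) \<times> {0..<N}"
      using pos_mod_sign[OF assms(2), of k] pos_mod_bound[OF assms(2), of k] fk by simp
  qed
  moreover have "finite ((PiE {0..<N} (\<lambda>_. carrier P)) \<times> {0..<N})"
    using assms by (intro finite_cartesian_product finite_PiE) auto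
  ultimately show ?thesis by (meson finite_imageD finite_subset)
qed

text \<open>Gives the loop at \<open>i\<close> the label \<open>lam i h\<close> for every \<open>h\<close> in \<open>H\<close>, and
  the edge from \<open>i\<close> to \<open>i + \<theta> x\<close> the label \<open>Y x i\<close> for every generator \<open>x\<close>.\<close>

definition labelling ::
    "'x set \<Rightarrow> ('h, 'c) monoid_scheme \<Rightarrow> ('p, 'd) monoid_scheme \<Rightarrow> int
      \<Rightarrow> (int \<Rightarrow> 'h \<Rightarrow> 'p) \<Rightarrow> ('x \<Rightarrow> int \<Rightarrow> 'p) \<Rightarrow> bool"
  where "labelling Xs H P N lam Y \<longleftrightarrow>
    (\<forall>i. lam i \<in> hom H P \<and> (\<forall>h\<in>carrier H. lam (i + N) h = lam i h)) \<and>
    (\<forall>x\<in>Xs. \<forall>i. Y x i \<in> carrier P \<and> Y x (i + N) = Y x i)"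

text \<open>For such a homomorphism, \<open>fst (\<Psi> g) i\<close> is the label of the path
  spelled by \<open>g\<close> from vertex \<open>i\<close>, and \<open>snd (\<Psi> g)\<close> is its
  displacement modulo \<open>N\<close>.\<close>

definition represents ::
    "'x set \<Rightarrow> ('h, 'c) monoid_scheme \<Rightarrow> ('p, 'd) monoid_scheme \<Rightarrow> ('x \<Rightarrow> int) \<Rightarrow> int
      \<Rightarrow> (int \<Rightarrow> 'h \<Rightarrow> 'p) \<Rightarrow> ('x \<Rightarrow> int \<Rightarrow> 'p)
      \<Rightarrow> (('h + ('x \<times> bool) list set) list set \<Rightarrow> (int \<Rightarrow> 'p) \<times> int) \<Rightarrow> bool"
  where "represents Xs H P \<theta> N lam Y \<Psi> \<longleftrightarrow>
    \<Psi> \<in> hom (ambient_group Xs H) (shift_wreath P N) \<and>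
    (\<forall>h\<in>carrier H. \<Psi> (free_product_inl H (free_group Xs) h) = (\<lambda>i. lam i h, 0)) \<and>
    (\<forall>x\<in>Xs. \<Psi> (free_product_inr H (free_group Xs) (free_gen Xs x)) = (Y x, \<theta> x mod N))"

lemma labelling_represents:
  assumes "group H" "group P" "labelling Xs H P N lam Y"
  obtains \<Psi> where "represents Xs H P \<theta> N lam Y \<Psi>"
proof -
  have "(\<lambda>h. (\<lambda>i. lam i h, 0)) \<in> hom H (shift_wreath P N)"
    using assms(3) by (auto simp: hom_def shift_wreath_def labelling_def Pi_def)
  moreover have "(Y x, \<theta> x mod N) \<in> carrier (shift_wreath P N)" if "x \<in> Xs" for x
    using assms(3) that by (auto simp: shift_wreath_def labelling_def)
  ultimately show ?thesis
    using that ambient_hom_exists[OF assms(1) group_shift_wreath[OF assms(2)],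
        of "\<lambda>h. (\<lambda>i. lam i h, 0)" N Xs "\<lambda>x. (Y x, \<theta> x mod N)"]
    unfolding represents_def by metis
qed

lemma represents_mult:
  assumes "represents Xs H P \<theta> N lam Y \<Psi>"
    and "g \<in> carrier (ambient_group Xs H)" "g' \<in> carrier (ambient_group Xs H)"
  shows "fst (\<Psi> (g \<otimes>\<^bsub>ambient_group Xs H\<^esub> g')) i = fst (\<Psi> g) i \<otimes>\<^bsub>P\<^esub> fst (\<Psi> g') (i + snd (\<Psi> g))"
    "snd (\<Psi> (g \<otimes>\<^bsub>ambient_group Xs H\<^esub> g')) = (snd (\<Psi> g) + snd (\<Psi> g')) mod N"
  using assms hom_mult[of \<Psi> "ambient_group Xs H" "shift_wreath P N" g g']
  by (auto simp: represents_def shift_wreath_def split_beta)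

lemma represents_periodic:
  assumes "represents Xs H P \<theta> N lam Y \<Psi>" "g \<in> carrier (ambient_group Xs H)"
  shows "fst (\<Psi> g) (i + N) = fst (\<Psi> g) i" "snd (\<Psi> g) mod N = snd (\<Psi> g)"
    "fst (\<Psi> g) i \<in> carrier P"
  using assms by (auto simp: represents_def shift_wreath_def hom_def Pi_def split_beta)

text \<open>An inverse generator read at \<open>i\<close> runs backwards along the edge that starts
  at \<open>i - \<theta> x\<close>.\<close>

lemma represents_inv_gen:
  assumes "group H" "group P" "represents Xs H P \<theta> N lam Y \<Psi>" "x \<in> Xs"
  shows "\<Psi> (inv\<^bsub>ambient_group Xs H\<^esub> free_product_inr H (free_group Xs) (free_gen Xs x)) =
    (\<lambda>i. inv\<^bsub>P\<^esub> Y x (i - \<theta> x), (- \<theta> x) mod N)"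
proof -
  interpret P: group P by fact
  interpret A: group "ambient_group Xs H" by (rule group_ambient_group) fact
  interpret W: group "shift_wreath P N" by (rule group_shift_wreath) fact
  interpret h: group_hom "ambient_group Xs H" "shift_wreath P N" \<Psi>
    using assms(3) by unfold_locales (simp add: represents_def)
  let ?g = "free_product_inr H (free_group Xs) (free_gen Xs x)"
  have g: "?g \<in> carrier (ambient_group Xs H)" using assms by simp
  have e: "\<Psi> ?g = (Y x, \<theta> x mod N)" using assms by (simp add: represents_def)
  have Y: "Y x i \<in> carrier P" "Y x (i + N) = Y x i" for i
    using represents_periodic[OF assms(3) g] e by auto
  have sh: "Y x (i + N - \<theta> x) = Y x (i - \<theta> x)" for i
    using Y(2)[of "i - \<theta> x"] by (simp add: algebra_simps)
  have "\<Psi> (inv\<^bsub>ambient_group Xs H\<^esub> ?g) = inv\<^bsub>shift_wreath P N\<^esub> (Y x, \<theta> x mod N)"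
    using e g by simp
  also have "\<dots> = (\<lambda>i. inv\<^bsub>P\<^esub> Y x (i - \<theta> x), (- \<theta> x) mod N)"
  proof (rule W.inv_equality)
    show "(\<lambda>i. inv\<^bsub>P\<^esub> Y x (i - \<theta> x), - \<theta> x mod N) \<otimes>\<^bsub>shift_wreath P N\<^esub> (Y x, \<theta> x mod N) =
        \<one>\<^bsub>shift_wreath P N\<^esub>"
      using Y by (auto simp: shift_wreath_def periodic_mod[of "Y x" N, OF Y(2)] mod_simps)
    show "(Y x, \<theta> x mod N) \<in> carrier (shift_wreath P N)"
      using Y by (auto simp: shift_wreath_def)
    show "(\<lambda>i. inv\<^bsub>P\<^esub> Y x (i - \<theta> x), - \<theta> x mod N) \<in> carrier (shift_wreath P N)"
      using Y sh by (auto simp: shift_wreath_def)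
  qed
  finally show ?thesis .
qed

text \<open>An element only reads the labels along its path, so a labelling that agrees with the image of
  another one on a long enough interval takes the same value.\<close>

lemma represents_local:
  assumes "group H" "group K" "group P" "\<psi> \<in> hom K P"
    and \<Psi>: "represents Xs H K \<theta> 0 lam Y \<Psi>"
    and "g \<in> carrier (ambient_group Xs H)"
  shows "\<exists>B. \<forall>N lam' Y' \<Psi>'. represents Xs H P \<theta> N lam' Y' \<Psi>' \<longrightarrow>
    (\<forall>i. \<bar>i\<bar> \<le> B \<longrightarrow> (\<forall>h\<in>carrier H. lam' i h = \<psi> (lam i h)) \<and> (\<forall>x\<in>Xs. Y' x i = \<psi> (Y x i))) \<longrightarrow>
    fst (\<Psi>' g) j = \<psi> (fst (\<Psi> g) j)"
proof -
  let ?A = "ambient_group Xs H"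
  interpret A: group ?A by (rule group_ambient_group) fact
  interpret K: group K by fact
  interpret P: group P by fact
  interpret \<psi>: group_hom K P \<psi> using assms(4) by unfold_locales
  define agree where "agree B lam' Y' \<longleftrightarrow> (\<forall>i. \<bar>i\<bar> \<le> B \<longrightarrow>
    (\<forall>h\<in>carrier H. lam' i h = \<psi> (lam i h)) \<and> (\<forall>x\<in>Xs. Y' x i = \<psi> (Y x i)))" for B lam' Y'
  have agreeD: "agree B lam' Y'" if "agree B' lam' Y'" "B \<le> B'" for B B' lam' Y'
    using that by (auto simp: agree_def)
  \<comment> \<open>After the prefix \<open>s\<close>, the path of \<open>g\<close> starts at
    \<open>j + snd (\<Psi> s)\<close>. In the target this vertex is only known modulo
    \<open>N\<close>, which periodicity makes harmless.\<close>
  have step: "\<exists>B. \<forall>N lam' Y' \<Psi>'. represents Xs H P \<theta> N lam' Y' \<Psi>' \<longrightarrow> agree B lam' Y' \<longrightarrow>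
      fst (\<Psi>' (s \<otimes>\<^bsub>?A\<^esub> g)) j = \<psi> (fst (\<Psi> (s \<otimes>\<^bsub>?A\<^esub> g)) j)"
    if s: "s \<in> carrier ?A" and g: "g \<in> carrier ?A"
      and sg: "\<And>N lam' Y' \<Psi>'. represents Xs H P \<theta> N lam' Y' \<Psi>' \<Longrightarrow> agree B0 lam' Y' \<Longrightarrow>
        fst (\<Psi>' s) j = \<psi> (fst (\<Psi> s) j) \<and> snd (\<Psi>' s) = snd (\<Psi> s) mod N"
      and IH: "\<And>j. \<exists>B. \<forall>N lam' Y' \<Psi>'. represents Xs H P \<theta> N lam' Y' \<Psi>' \<longrightarrow> agree B lam' Y' \<longrightarrow>
        fst (\<Psi>' g) j = \<psi> (fst (\<Psi> g) j)"
    for s g j B0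
  proof -
    obtain B1 where B1: "\<And>N lam' Y' \<Psi>'. represents Xs H P \<theta> N lam' Y' \<Psi>' \<Longrightarrow> agree B1 lam' Y' \<Longrightarrow>
        fst (\<Psi>' g) (j + snd (\<Psi> s)) = \<psi> (fst (\<Psi> g) (j + snd (\<Psi> s)))"
      using IH by blast
    show ?thesis
    proof (intro exI[of _ "max B0 B1"] allI impI)
      fix N lam' Y' \<Psi>' assume r: "represents Xs H P \<theta> N lam' Y' \<Psi>'" and a: "agree (max B0 B1) lam' Y'"
      have "fst (\<Psi>' g) (j + snd (\<Psi>' s)) = fst (\<Psi>' g) (j + snd (\<Psi> s))"
        using sg[OF r agreeD[OF a]] represents_periodic(1)[OF r g]
        by (simp add: periodic_mod[of "fst (\<Psi>' g)" N])
      then show "fst (\<Psi>' (s \<otimes>\<^bsub>?A\<^esub> g)) j = \<psi> (fst (\<Psi> (s \<otimes>\<^bsub>?A\<^esub> g)) j)"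
        using B1[OF r agreeD[OF a]] sg[OF r agreeD[OF a]] represents_periodic(3)[OF \<Psi>] s g
        by (simp add: represents_mult[OF r s g] represents_mult[OF \<Psi> s g])
    qed
  qed
  \<comment> \<open>All starting vertices are treated at once, because a prefix moves the start of
    the remaining path.\<close>
  have "\<forall>j. \<exists>B. \<forall>N lam' Y' \<Psi>'. represents Xs H P \<theta> N lam' Y' \<Psi>' \<longrightarrow> agree B lam' Y' \<longrightarrow>
      fst (\<Psi>' g) j = \<psi> (fst (\<Psi> g) j)"
    using assms(1,6)
  proof (induction rule: ambient_induct)
    case one
    have "\<Psi>' \<one>\<^bsub>?A\<^esub> = (\<lambda>_. \<one>\<^bsub>P\<^esub>, 0)" if "represents Xs H P \<theta> N lam' Y' \<Psi>'" for N lam' Y' \<Psi>'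
      using that hom_one[OF _ A.group_axioms group_shift_wreath[OF assms(3)], of \<Psi>' N]
      by (auto simp: represents_def shift_wreath_def)
    moreover have "\<Psi> \<one>\<^bsub>?A\<^esub> = (\<lambda>_. \<one>\<^bsub>K\<^esub>, 0)"
      using \<Psi> hom_one[OF _ A.group_axioms group_shift_wreath[OF assms(2)], of \<Psi> 0]
      by (auto simp: represents_def shift_wreath_def)
    ultimately show ?case by (metis fst_conv \<psi>.hom_one)
  next
    case (inl h g)
    show ?case
    proof
      fix j show "\<exists>B. \<forall>N lam' Y' \<Psi>'. represents Xs H P \<theta> N lam' Y' \<Psi>' \<longrightarrow> agree B lam' Y' \<longrightarrow>
        fst (\<Psi>' (free_product_inl H (free_group Xs) h \<otimes>\<^bsub>?A\<^esub> g)) j =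
        \<psi> (fst (\<Psi> (free_product_inl H (free_group Xs) h \<otimes>\<^bsub>?A\<^esub> g)) j)"
        by (rule step[of _ _ "\<bar>j\<bar>"])
          (use inl assms(1) \<Psi> in \<open>auto simp: represents_def agree_def\<close>)
    qed
  next
    case (gen x g)
    show ?case
    proof
      fix j show "\<exists>B. \<forall>N lam' Y' \<Psi>'. represents Xs H P \<theta> N lam' Y' \<Psi>' \<longrightarrow> agree B lam' Y' \<longrightarrow>
        fst (\<Psi>' (free_product_inr H (free_group Xs) (free_gen Xs x) \<otimes>\<^bsub>?A\<^esub> g)) j =
        \<psi> (fst (\<Psi> (free_product_inr H (free_group Xs) (free_gen Xs x) \<otimes>\<^bsub>?A\<^esub> g)) j)"
        by (rule step[of _ _ "\<bar>j\<bar>"])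
          (use gen assms(1) \<Psi> in \<open>auto simp: represents_def agree_def\<close>)
    qed
  next
    case (inv_gen x g)
    have Y: "Y x i \<in> carrier K" for i
      using represents_periodic(3)[OF \<Psi>, of "free_product_inr H (free_group Xs) (free_gen Xs x)" i]
        \<Psi> inv_gen(1) assms(1) by (simp add: represents_def)
    show ?case
    proof
      fix j show "\<exists>B. \<forall>N lam' Y' \<Psi>'. represents Xs H P \<theta> N lam' Y' \<Psi>' \<longrightarrow> agree B lam' Y' \<longrightarrow>
        fst (\<Psi>' (inv\<^bsub>?A\<^esub> free_product_inr H (free_group Xs) (free_gen Xs x) \<otimes>\<^bsub>?A\<^esub> g)) j =
        \<psi> (fst (\<Psi> (inv\<^bsub>?A\<^esub> free_product_inr H (free_group Xs) (free_gen Xs x) \<otimes>\<^bsub>?A\<^esub> g)) j)"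
      proof (rule step[of _ _ "\<bar>j - \<theta> x\<bar>"])
        fix N lam' Y' \<Psi>' assume r: "represents Xs H P \<theta> N lam' Y' \<Psi>'"
          and a: "agree \<bar>j - \<theta> x\<bar> lam' Y'"
        show "fst (\<Psi>' (inv\<^bsub>?A\<^esub> free_product_inr H (free_group Xs) (free_gen Xs x))) j =
            \<psi> (fst (\<Psi> (inv\<^bsub>?A\<^esub> free_product_inr H (free_group Xs) (free_gen Xs x))) j) \<and>
          snd (\<Psi>' (inv\<^bsub>?A\<^esub> free_product_inr H (free_group Xs) (free_gen Xs x))) =
            snd (\<Psi> (inv\<^bsub>?A\<^esub> free_product_inr H (free_group Xs) (free_gen Xs x))) mod N"
          using a Y inv_gen(1)
          by (simp add: represents_inv_gen[OF assms(1,3) r inv_gen(1)]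
              represents_inv_gen[OF assms(1,2) \<Psi> inv_gen(1)] agree_def)
      qed (use inv_gen assms(1) in auto)
    qed
  qed
  then show ?thesis unfolding agree_def by blast
qed

section \<open>Reversible recurrences\<close>

text \<open>Equation \<open>j\<close> sees the \<open>w + 1\<close> entries from \<open>j\<close> to
  \<open>j + w\<close> and determines each of the two outermost from the others. So \<open>w\<close>
  consecutive entries form a state that evolves uniquely in both directions.\<close>

locale reversible_recurrence =
  fixes w :: int and C :: "'p set" and E :: "int \<Rightarrow> (int \<Rightarrow> 'p) \<Rightarrow> bool"
  assumes w_nonneg: "0 \<le> w"
    and local: "\<And>j u v. (\<And>i. j \<le> i \<Longrightarrow> i \<le> j + w \<Longrightarrow> u i = v i) \<Longrightarrow> E j u \<longleftrightarrow> E j v"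
    and top: "\<And>j u. range u \<subseteq> C \<Longrightarrow> \<exists>!p. p \<in> C \<and> E j (u(j + w := p))"
    and bottom: "\<And>j u. range u \<subseteq> C \<Longrightarrow> \<exists>!p. p \<in> C \<and> E j (u(j := p))"
begin

text \<open>The reversal \<open>i \<mapsto> w - 1 - i\<close> preserves the initial window from 0 to
  \<open>w - 1\<close>, swaps the two ends of every equation, and turns equations with negative
  index into those with nonnegative index.\<close>

lemma reflected: "reversible_recurrence w C (\<lambda>j u. E (- 1 - j) (\<lambda>i. u (w - 1 - i)))"
proof (unfold_locales, goal_cases)
  case 1
  show ?case by (rule w_nonneg)
next
  case (2 j u v)
  show ?case by (rule local) (use 2 in auto)
next
  case (3 j u)
  have e: "(\<lambda>i. (u(j + w := p)) (w - 1 - i)) = (\<lambda>i. u (w - 1 - i))(- 1 - j := p)" for p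
    by (auto simp: fun_eq_iff)
  show ?case unfolding e by (rule bottom) (use 3 in auto)
next
  case (4 j u)
  have e: "(\<lambda>i. (u(j := p)) (w - 1 - i)) = (\<lambda>i. u (w - 1 - i))(- 1 - j + w := p)" for p
    by (auto simp: fun_eq_iff)
  show ?case unfolding e by (rule top) (use 4 in auto)
qed

lemma forward_exists:
  assumes "range u0 \<subseteq> C"
  shows "\<exists>u. range u \<subseteq> C \<and> (\<forall>i<w. u i = u0 i) \<and> (\<forall>j\<ge>0. E j u)"
proof -
  \<comment> \<open>Step \<open>k\<close> fills in entry \<open>k + w\<close>, the only entry of
    equation \<open>k\<close> that is not yet final.\<close>
  define nxt where "nxt k u = u(int k + w := (THE p. p \<in> C \<and> E (int k) (u(int k + w := p))))" for k u
  define U where "U = rec_nat u0 nxt"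
  have U: "U 0 = u0" "U (Suc k) = nxt k (U k)" for k by (simp_all add: U_def)
  have UC: "range (U k) \<subseteq> C" for k
  proof (induction k)
    case (Suc k)
    from theI'[OF top[OF this, of "int k"]] show ?case using Suc by (auto simp: U nxt_def)
  qed (simp add: U assms)
  have UE: "E (int k) (U (Suc k))" for k
    using theI'[OF top[of "U k" "int k", OF UC]] by (simp add: U nxt_def)
  have stable: "U (k + d) i = U k i" if "i < int k + w" for k d i
    using that by (induction d) (simp_all add: U nxt_def)
  \<comment> \<open>Entry \<open>i\<close> is written in step \<open>i - w\<close>, so stage
    \<open>i - w + 1\<close> is the first one at which it is final.\<close>
  define u where "u i = U (nat (i - w + 1)) i" for i
  have u: "u i = U k i" if "i < int k + w" for i k
  proof -
    have "nat (i - w + 1) \<le> k" using that by simp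
    moreover have "i < int (nat (i - w + 1)) + w" by simp
    ultimately show ?thesis using stable[of i "nat (i - w + 1)" "k - nat (i - w + 1)"] by (simp add: u_def)
  qed
  have "E j u" if "j \<ge> 0" for j
  proof -
    have "E (int (nat j)) u \<longleftrightarrow> E (int (nat j)) (U (Suc (nat j)))"
      using that by (intro local u) auto
    then show ?thesis using UE[of "nat j"] that by simp
  qed
  moreover have "range u \<subseteq> C" using UC by (auto simp: u_def)
  moreover have "u i = u0 i" if "i < w" for i using u[of i 0] that by (simp add: U)
  ultimately show ?thesis by blast
qed

lemma solution_exists:
  assumes "range u0 \<subseteq> C"
  shows "\<exists>u. range u \<subseteq> C \<and> (\<forall>i. 0 \<le> i \<longrightarrow> i < w \<longrightarrow> u i = u0 i) \<and> (\<forall>j. E j u)"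
proof -
  obtain f where f: "range f \<subseteq> C" "\<And>i. i < w \<Longrightarrow> f i = u0 i" "\<And>j. j \<ge> 0 \<Longrightarrow> E j f"
    using forward_exists[OF assms] by blast
  interpret r: reversible_recurrence w C "\<lambda>j u. E (- 1 - j) (\<lambda>i. u (w - 1 - i))" by (rule reflected)
  \<comment> \<open>The reflected problem starts from \<open>f\<close> and keeps all entries at
    \<open>i \<ge> 0\<close>, hence also the equations already solved there.\<close>
  obtain g where g: "range g \<subseteq> C" "\<And>i. i < w \<Longrightarrow> g i = f (w - 1 - i)"
    "\<And>j. j \<ge> 0 \<Longrightarrow> E (- 1 - j) (\<lambda>i. g (w - 1 - i))"
    using r.forward_exists[of "\<lambda>i. f (w - 1 - i)"] f(1) by blast
  define u where "u i = g (w - 1 - i)" for i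
  have uf: "u i = f i" if "i \<ge> 0" for i using g(2)[of "w - 1 - i"] that by (simp add: u_def)
  have "E j u" for j
  proof (cases "j \<ge> 0")
    case True
    then show ?thesis using local[of j u f] uf f(3) by auto
  next
    case False
    then show ?thesis using g(3)[of "- 1 - j"] by (simp add: u_def[abs_def])
  qed
  moreover have "range u \<subseteq> C" using g(1) by (auto simp: u_def)
  ultimately show ?thesis using uf f(2) by (intro exI[of _ u]) simp
qed

lemma forward_unique:
  assumes "range u \<subseteq> C" "range v \<subseteq> C" "\<And>i. 0 \<le> i \<Longrightarrow> i < w \<Longrightarrow> u i = v i"
    and "\<And>j. 0 \<le> j \<Longrightarrow> j < b \<Longrightarrow> E j u \<and> E j v"
  shows "0 \<le> i \<Longrightarrow> i < b + w \<Longrightarrow> u i = v i"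
proof -
  have *: "\<forall>i. 0 \<le> i \<and> i < int k + w \<longrightarrow> u i = v i" if "int k \<le> b" for k
    using that
  proof (induction k)
    case (Suc k)
    have IH: "u i = v i" if "0 \<le> i" "i < int k + w" for i using Suc that by auto
    let ?t = "int k + w"
    \<comment> \<open>Both \<open>u ?t\<close> and \<open>v ?t\<close> complete the window of
      \<open>v\<close> to a solution of equation \<open>k\<close>, so they coincide.\<close>
    have "E (int k) (v(?t := u ?t)) \<longleftrightarrow> E (int k) u"
      by (rule local) (use IH in auto)
    then have "u ?t \<in> C \<and> E (int k) (v(?t := u ?t))"
      using assms(1,4) Suc.prems by auto
    moreover have "v ?t \<in> C \<and> E (int k) (v(?t := v ?t))"
      using assms(2,4) Suc.prems by auto
    ultimately have t: "u ?t = v ?t" using top[OF assms(2), of "int k"] by blast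
    show ?case
    proof (intro allI impI)
      fix i assume "0 \<le> i \<and> i < int (Suc k) + w"
      then show "u i = v i" using IH[of i] t by (cases "i = ?t") auto
    qed
  qed (use assms in auto)
  assume "0 \<le> i" "i < b + w"
  then show "u i = v i" using assms(3)[of i] *[of "nat b"] by (cases "b \<ge> 0") auto
qed

text \<open>The bound \<open>b\<close> lets solutions of recurrences that agree only near 0 be
  compared.\<close>

lemma solution_unique:
  assumes "range u \<subseteq> C" "range v \<subseteq> C" "\<And>i. 0 \<le> i \<Longrightarrow> i < w \<Longrightarrow> u i = v i"
    and "\<And>j. \<bar>j\<bar> \<le> b \<Longrightarrow> E j u \<and> E j v" and "\<bar>i\<bar> \<le> b"
  shows "u i = v i"
proof (cases "i \<ge> 0")
  case True
  show ?thesis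
    using forward_unique[OF assms(1,2), of b i] assms(3-5) True w_nonneg
    by (cases "i < w") (auto intro: forward_unique[OF assms(1,2), of "b + 1" i])
next
  case False
  interpret r: reversible_recurrence w C "\<lambda>j u. E (- 1 - j) (\<lambda>i. u (w - 1 - i))" by (rule reflected)
  have "u (w - 1 - (w - 1 - i)) = v (w - 1 - (w - 1 - i))"
    by (rule r.forward_unique[of "\<lambda>i. u (w - 1 - i)" "\<lambda>i. v (w - 1 - i)" b "w - 1 - i"])
      (use assms False w_nonneg in auto)
  then show ?thesis by simp
qed

text \<open>Pigeonhole: among the translates by multiples of \<open>N\<close>, all of them
  solutions, two have the same state. Reversibility makes them equal everywhere, so the period holds
  on all integers and not just eventually.\<close>

lemma solution_periodic:
  assumes "finite C" "N > 0" "\<And>j u. E (j + N) u \<longleftrightarrow> E j (\<lambda>i. u (i + N))"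
    and "range u \<subseteq> C" "\<And>j. E j u"
  obtains k where "k > 0" "\<And>i. u (i + int k * N) = u i"
proof -
  define v where "v k = (\<lambda>i. u (i + int k * N))" for k
  have v: "E j (v k)" for j k
  proof (induction k arbitrary: j)
    case 0
    then show ?case using assms(5) by (simp add: v_def)
  next
    case (Suc k)
    have "v (Suc k) = (\<lambda>i. v k (i + N))" by (auto simp: v_def algebra_simps)
    then show ?case using Suc[of "j + N"] assms(3) by simp
  qed
  have vC: "range (v k) \<subseteq> C" for k using assms(4) by (auto simp: v_def)
  have "(\<lambda>k. restrict (v k) {0..<w}) ` UNIV \<subseteq> (PiE {0..<w} (\<lambda>_. C))"
    using vC by (auto simp: image_subset_iff)
  moreover have "finite (PiE {0..<w} (\<lambda>_. C))" using assms(1) by (intro finite_PiE) auto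
  ultimately have "\<not> inj (\<lambda>k. restrict (v k) {0..<w})"
    by (meson finite_imageD finite_subset infinite_UNIV_nat)
  then obtain k1 k2 where k: "k1 < k2" "restrict (v k1) {0..<w} = restrict (v k2) {0..<w}"
    unfolding inj_def by (metis nat_neq_iff)
  have eq: "v k1 i = v k2 i" for i
  proof (rule solution_unique[OF vC vC])
    show "v k1 i = v k2 i" if "0 \<le> i" "i < w" for i
      using fun_cong[OF k(2), of i] that by simp
    show "E j (v k1) \<and> E j (v k2)" for j using v by blast
    show "\<bar>i\<bar> \<le> \<bar>i\<bar>" by simp
  qed
  have "u (i + int (k2 - k1) * N) = u i" for i
    using eq[of "i - int k1 * N"] k(1) by (simp add: v_def of_nat_diff algebra_simps)
  then show ?thesis using that[of "k2 - k1"] k(1) by simp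
qed

end

section \<open>Labels along a word\<close>

definition word_height :: "('x \<Rightarrow> int) \<Rightarrow> ('x \<times> int \<times> 'h) list \<Rightarrow> int"
  where "word_height \<theta> R = (\<Sum>(x, e, h)\<leftarrow>R. e * \<theta> x)"

lemma word_height_simps [simp]:
  "word_height \<theta> [] = 0"
  "word_height \<theta> ((x, e, h) # R) = e * \<theta> x + word_height \<theta> R"
  by (simp_all add: word_height_def)

text \<open>For the relator this is the V_j of the overview.\<close>

fun word_label ::
    "('p, 'd) monoid_scheme \<Rightarrow> ('x \<Rightarrow> int) \<Rightarrow> (int \<Rightarrow> 'h \<Rightarrow> 'p) \<Rightarrow> ('x \<Rightarrow> int \<Rightarrow> 'p)
      \<Rightarrow> ('x \<times> int \<times> 'h) list \<Rightarrow> int \<Rightarrow> 'p" where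
  "word_label P \<theta> lam Y [] j = \<one>\<^bsub>P\<^esub>"
| "word_label P \<theta> lam Y ((x, e, h) # R) j =
    (if e = 1 then Y x j else inv\<^bsub>P\<^esub> Y x (j - \<theta> x)) \<otimes>\<^bsub>P\<^esub> lam (j + e * \<theta> x) h
      \<otimes>\<^bsub>P\<^esub> word_label P \<theta> lam Y R (j + e * \<theta> x)"

lemma represents_relator:
  assumes "group H" "group P" and \<Psi>: "represents Xs H P \<theta> N lam Y \<Psi>"
    and "\<forall>(x, e, h)\<in>set R. x \<in> Xs \<and> (e = 1 \<or> e = -1) \<and> h \<in> carrier H"
  shows "relator Xs H R \<in> carrier (ambient_group Xs H) \<and>
    \<Psi> (relator Xs H R) = (word_label P \<theta> lam Y R, word_height \<theta> R mod N)"
proof -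
  let ?A = "ambient_group Xs H"
  interpret A: group ?A by (rule group_ambient_group) fact
  show ?thesis
    using assms(4)
  proof (induction R)
    case Nil
    have "\<Psi> \<one>\<^bsub>?A\<^esub> = (\<lambda>_. \<one>\<^bsub>P\<^esub>, 0)"
      using \<Psi> hom_one[OF _ A.group_axioms group_shift_wreath[OF assms(2)], of \<Psi> N]
      by (auto simp: represents_def shift_wreath_def)
    then show ?case by (auto simp: relator_def)
  next
    case (Cons c R)
    obtain x e h where c: "c = (x, e, h)" by (cases c)
    then have xeh: "x \<in> Xs" "e = 1 \<or> e = -1" "h \<in> carrier H" using Cons.prems by auto
    let ?x = "free_product_inr H (free_group Xs) (free_gen Xs x)"
    let ?h = "free_product_inl H (free_group Xs) h"
    let ?xe = "?x [^]\<^bsub>?A\<^esub> e"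
    have IH: "relator Xs H R \<in> carrier ?A"
      "\<Psi> (relator Xs H R) = (word_label P \<theta> lam Y R, word_height \<theta> R mod N)"
      using Cons by auto
    have cl: "?x \<in> carrier ?A" "?h \<in> carrier ?A" "?xe \<in> carrier ?A"
      using xeh assms(1) by simp_all
    have xe: "?xe = (if e = 1 then ?x else inv\<^bsub>?A\<^esub> ?x)"
      using xeh(2) cl(1) by (auto simp: A.int_pow_neg)
    have \<Psi>xe: "\<Psi> ?xe = (\<lambda>j. if e = 1 then Y x j else inv\<^bsub>P\<^esub> Y x (j - \<theta> x), (e * \<theta> x) mod N)"
      using \<Psi> xeh by (auto simp: xe represents_inv_gen[OF assms(1,2) \<Psi>] represents_def)
    have \<Psi>h: "\<Psi> ?h = (\<lambda>i. lam i h, 0)" using \<Psi> xeh by (simp add: represents_def)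
    have rel: "relator Xs H (c # R) = ?xe \<otimes>\<^bsub>?A\<^esub> ?h \<otimes>\<^bsub>?A\<^esub> relator Xs H R"
      by (simp add: relator_def c)
    have lamN: "lam (i + N) h = lam i h" for i
      using represents_periodic(1)[OF \<Psi> cl(2)] \<Psi>h by simp
    have RN: "word_label P \<theta> lam Y R (i + N) = word_label P \<theta> lam Y R i" for i
      using represents_periodic(1)[OF \<Psi> IH(1)] IH(2) by simp
    have "fst (\<Psi> (relator Xs H (c # R))) j = word_label P \<theta> lam Y (c # R) j" for j
      unfolding rel using cl IH(1) by (simp add: represents_mult[OF \<Psi>] \<Psi>xe \<Psi>h IH(2) c
          periodic_mod[of "\<lambda>i. lam i h" N, OF lamN] periodic_mod[of "word_label P \<theta> lam Y R" N, OF RN])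
    moreover have "snd (\<Psi> (relator Xs H (c # R))) = word_height \<theta> (c # R) mod N"
      unfolding rel using cl IH(1) by (simp add: represents_mult[OF \<Psi>] \<Psi>xe \<Psi>h IH(2) c mod_simps)
    moreover have "relator Xs H (c # R) \<in> carrier ?A" unfolding rel using cl IH(1) by simp
    ultimately show ?case by (simp add: prod_eq_iff fun_eq_iff)
  qed
qed

text \<open>The origin, in the labelled graph, of the edge traversed by the \<open>s\<close>-th letter
  (counting from 0): the letter \<open>x\<^sup>-\<^sup>1\<close> traverses an edge backwards.\<close>

definition edge_origin :: "('x \<Rightarrow> int) \<Rightarrow> ('x \<times> int \<times> 'h) list \<Rightarrow> nat \<Rightarrow> int"
  where "edge_origin \<theta> R s = word_height \<theta> (take s R) +
    (case R ! s of (x, e, h) \<Rightarrow> if e = 1 then 0 else - \<theta> x)"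

definition letter_label ::
    "('p, 'd) monoid_scheme \<Rightarrow> ('x \<Rightarrow> int) \<Rightarrow> (int \<Rightarrow> 'h \<Rightarrow> 'p) \<Rightarrow> ('x \<Rightarrow> int \<Rightarrow> 'p)
      \<Rightarrow> ('x \<times> int \<times> 'h) list \<Rightarrow> int \<Rightarrow> nat \<Rightarrow> 'p" where
  "letter_label P \<theta> lam Y R j s = (case R ! s of (x, e, h) \<Rightarrow>
    (if e = 1 then Y x (j + edge_origin \<theta> R s) else inv\<^bsub>P\<^esub> Y x (j + edge_origin \<theta> R s))
      \<otimes>\<^bsub>P\<^esub> lam (j + word_height \<theta> (take (Suc s) R)) h)"

text \<open>One factor per letter, with positions relative to the whole word, so that the single
  factor containing a given unknown can be singled out.\<close>

lemma word_label_conv_letters: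
  "word_label P \<theta> lam Y R j =
    foldr (\<otimes>\<^bsub>P\<^esub>) (map (letter_label P \<theta> lam Y R j) [0..<length R]) \<one>\<^bsub>P\<^esub>"
proof (induction R arbitrary: j)
  case (Cons c R)
  obtain x e h where c: "c = (x, e, h)" by (cases c)
  have "letter_label P \<theta> lam Y (c # R) j (Suc s) = letter_label P \<theta> lam Y R (j + e * \<theta> x) s" for s
    by (simp add: letter_label_def edge_origin_def c algebra_simps split: prod.split)
  moreover have "letter_label P \<theta> lam Y (c # R) j 0 =
      (if e = 1 then Y x j else inv\<^bsub>P\<^esub> Y x (j - \<theta> x)) \<otimes>\<^bsub>P\<^esub> lam (j + e * \<theta> x) h"
    by (simp add: letter_label_def edge_origin_def c)
  moreover have "[0..<length (c # R)] = 0 # map Suc [0..<length R]"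
    by (simp add: upt_conv_Cons map_Suc_upt del: upt_Suc)
  ultimately show ?case using Cons by (simp add: c comp_def del: upt_Suc)
qed simp

lemma (in monoid) foldr_mult_append:
  assumes "set xs \<subseteq> carrier G" "set ys \<subseteq> carrier G"
  shows "foldr (\<otimes>) (xs @ ys) \<one> = foldr (\<otimes>) xs \<one> \<otimes> foldr (\<otimes>) ys \<one>"
    and "foldr (\<otimes>) ys \<one> \<in> carrier G"
proof -
  show "foldr (\<otimes>) ys \<one> \<in> carrier G" using assms(2) by (induction ys) auto
  moreover have "foldr (\<otimes>) zs \<one> \<in> carrier G" if "set zs \<subseteq> carrier G" for zs
    using that by (induction zs) auto
  ultimately show "foldr (\<otimes>) (xs @ ys) \<one> = foldr (\<otimes>) xs \<one> \<otimes> foldr (\<otimes>) ys \<one>"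
    using assms(1) by (induction xs) (auto simp: m_assoc)
qed

text \<open>\<open>z\<close> is the prescribed path label, \<open>p\<close> the unknown edge label,
  \<open>P\<close> says that its edge is traversed forwards, \<open>c\<close> is a parameter
  attached to the edge, and \<open>d\<close> the following label from \<open>H\<close>.\<close>

lemma (in group) unique_factor:
  assumes "a \<in> carrier G" "b \<in> carrier G" "c \<in> carrier G" "d \<in> carrier G" "z \<in> carrier G"
  shows "\<exists>!p. p \<in> carrier G \<and>
    a \<otimes> ((if P then c \<otimes> p else inv (c \<otimes> p)) \<otimes> d) \<otimes> b = z"
proof -
  define y where "y = inv a \<otimes> z \<otimes> inv b \<otimes> inv d"
  have y: "y \<in> carrier G" using assms by (simp add: y_def)
  have iff: "a \<otimes> (t \<otimes> d) \<otimes> b = z \<longleftrightarrow> t = y" if "t \<in> carrier G" for t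
  proof
    assume "a \<otimes> (t \<otimes> d) \<otimes> b = z"
    then show "t = y" using assms that
      by (auto simp: y_def m_assoc inv_solve_left' inv_solve_right' simp flip: m_assoc)
        (simp add: m_assoc flip: inv_mult_group)
  next
    assume "t = y"
    then show "a \<otimes> (t \<otimes> d) \<otimes> b = z" using assms
      by (simp add: y_def m_assoc) (simp flip: m_assoc)
  qed
  let ?t = "\<lambda>p. if P then c \<otimes> p else inv (c \<otimes> p)"
  have t: "?t p = y \<longleftrightarrow> p = inv c \<otimes> (if P then y else inv y)" if "p \<in> carrier G" for p
  proof -
    have "inv (c \<otimes> p) = y \<longleftrightarrow> c \<otimes> p = inv y"
      using assms y that by (metis inv_inv m_closed)
    moreover have "c \<otimes> p = q \<longleftrightarrow> p = inv c \<otimes> q" if "q \<in> carrier G" for q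
      using assms \<open>p \<in> carrier G\<close> that by (auto simp: inv_solve_left)
    ultimately show ?thesis using y by simp
  qed
  have tc: "?t p \<in> carrier G" if "p \<in> carrier G" for p using that assms by simp
  have sol: "inv c \<otimes> (if P then y else inv y) \<in> carrier G" using assms y by simp
  show ?thesis
  proof (rule ex1I[of _ "inv c \<otimes> (if P then y else inv y)"])
    show "inv c \<otimes> (if P then y else inv y) \<in> carrier G \<and>
        a \<otimes> (?t (inv c \<otimes> (if P then y else inv y)) \<otimes> d) \<otimes> b = z"
      using sol iff[OF tc[OF sol]] t[OF sol] by blast
    fix p assume p: "p \<in> carrier G \<and> a \<otimes> (?t p \<otimes> d) \<otimes> b = z"
    then show "p = inv c \<otimes> (if P then y else inv y)"
      using iff[OF tc] t by blast
  qed
qed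

section \<open>Extremal letters\<close>

lemma word_height_append [simp]: "word_height \<theta> (R @ S) = word_height \<theta> R + word_height \<theta> S"
  by (simp add: word_height_def)

lemma height_skeleton:
  "j \<le> length R \<Longrightarrow> height \<theta> (skeleton R) j = word_height \<theta> (take j R)"
proof (induction j)
  case (Suc j)
  then have "height \<theta> (skeleton R) (Suc j) = word_height \<theta> (take j R)
      + snd (skeleton R ! j) * \<theta> (fst (skeleton R ! j))"
    by (simp add: height_def)
  also have "\<dots> = word_height \<theta> (take (Suc j) R)"
    using Suc.prems
    by (cases "R ! j") (auto simp: take_Suc_conv_app_nth skeleton_def)
  finally show ?case .
qed (simp add: height_def)

text \<open>The higher end of an edge exceeds its origin by a constant depending only on the
  generator, so origins of edges with the same generator compare like their higher ends.\<close>

lemma edge_top: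
  assumes "s < length R" "R ! s = (x, e, h)" "e = 1 \<or> e = -1"
  shows "edge_origin \<theta> R s + max 0 (\<theta> x) =
    max (word_height \<theta> (take s R)) (word_height \<theta> (take (Suc s) R))"
  using assms by (auto simp: edge_origin_def take_Suc_conv_app_nth)

text \<open>Only two letters touch the maximal vertex: the one at index \<open>k - 1\<close> ends
  there, and its cyclic successor, which starts there, is another generator. Every other occurrence
  of the generator therefore has both ends strictly below the maximum.\<close>

lemma unique_top_letter:
  assumes signs: "\<forall>(x, e, h)\<in>set R. e = 1 \<or> e = -1"
    and closed: "word_height \<theta> R = 0"
    and k: "k \<in> {1..length R}"
    and max: "\<forall>j\<in>{1..length R} - {k}. height \<theta> (skeleton R) j < height \<theta> (skeleton R) k"
    and neq: "fst (skeleton R ! (k - 1)) \<noteq> fst (skeleton R ! (k mod length R))"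
    and s: "s < length R" "s \<noteq> k - 1" "fst (R ! s) = fst (R ! (k - 1))"
  shows "edge_origin \<theta> R s < edge_origin \<theta> R (k - 1)"
proof -
  let ?\<phi> = "\<lambda>j. word_height \<theta> (take j R)"
  let ?a = "fst (R ! (k - 1))"
  have max': "?\<phi> j < ?\<phi> k" if "1 \<le> j" "j \<le> length R" "j \<noteq> k" for j
    using bspec[OF max, of j] that k by (simp add: height_skeleton)
  have end0: "?\<phi> (length R) = ?\<phi> 0" using closed by simp
  have "k mod length R < length R" using k by (intro mod_less_divisor) auto
  then have sk: "s \<noteq> k mod length R"
    using neq s k by (auto simp: skeleton_def split_beta)
  have top: "edge_origin \<theta> R i + max 0 (\<theta> ?a) = max (?\<phi> i) (?\<phi> (Suc i))"
    if "i < length R" "fst (R ! i) = ?a" for i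
  proof -
    obtain x e h where xeh: "R ! i = (x, e, h)" by (cases "R ! i")
    then have "e = 1 \<or> e = -1" using signs nth_mem[OF that(1)] by auto
    then show ?thesis using edge_top[OF that(1) xeh] that(2) xeh by simp
  qed
  have below: "?\<phi> j \<le> ?\<phi> k" if "j \<le> length R" for j
  proof (cases "j = k")
    case False
    show ?thesis
    proof (cases "j = 0")
      case True
      then show ?thesis using max'[of "length R"] end0 k by (cases "k = length R") auto
    qed (use max'[of j] that False in auto)
  qed simp
  \<comment> \<open>The maximum ranges over the heights with indices from 1 on; the height at index
    0 is covered by that at \<open>length R\<close>, as the path is closed.\<close>
  have "?\<phi> s < ?\<phi> k"
  proof (cases "s = 0")
    case True
    then have "k \<noteq> length R" using sk by auto
    then show ?thesis using True max'[of "length R"] end0 k by auto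
  next
    case False
    moreover have "s \<noteq> k" using sk s by auto
    ultimately show ?thesis using max'[of s] s by simp
  qed
  moreover have "?\<phi> (Suc s) < ?\<phi> k" using max'[of "Suc s"] s by auto
  moreover have "?\<phi> (k - 1) \<le> ?\<phi> k" by (rule below) (use k in auto)
  moreover have "Suc (k - 1) = k" using k by simp
  ultimately have "max (?\<phi> s) (?\<phi> (Suc s)) < ?\<phi> k" "max (?\<phi> (k - 1)) (?\<phi> (Suc (k - 1))) = ?\<phi> k"
    by simp_all
  moreover have "k - 1 < length R" using k by auto
  ultimately show ?thesis
    using top[OF s(1,3)] top[of "k - 1", OF _ HOL.refl] by linarith
qed

lemma word_height_uminus: "word_height (\<lambda>x. - \<theta> x) R = - word_height \<theta> R"
  by (induction R) (auto simp: word_height_def)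

lemma edge_origin_uminus: "edge_origin (\<lambda>x. - \<theta> x) R s = - edge_origin \<theta> R s"
  by (auto simp: edge_origin_def word_height_uminus split: prod.split)

lemma height_uminus: "height (\<lambda>x. - \<theta> x) W j = - height \<theta> W j"
  by (simp add: height_def sum_negf)

text \<open>The claim on the bottom letter is the one on the top letter for
  \<open>- \<theta>\<close>, which reverses all heights and edge origins.\<close>

lemma extremal_letters:
  assumes "M_presentation Xs H R"
  obtains \<theta> s0 s1 where "word_height \<theta> R = 0" "s0 < length R" "s1 < length R"
    "\<And>s. s < length R \<Longrightarrow> s \<noteq> s0 \<Longrightarrow> fst (R ! s) = fst (R ! s0) \<Longrightarrow>
      edge_origin \<theta> R s < edge_origin \<theta> R s0"
    "\<And>s. s < length R \<Longrightarrow> s \<noteq> s1 \<Longrightarrow> fst (R ! s) = fst (R ! s1) \<Longrightarrow>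
      edge_origin \<theta> R s > edge_origin \<theta> R s1"
proof -
  have signs: "\<forall>(x, e, h)\<in>set R. e = 1 \<or> e = -1"
    using assms by (auto simp: M_presentation_def relative_presentation_def)
  have len: "length (skeleton R) = length R" by (simp add: skeleton_def)
  from assms obtain \<theta> k l where *: "admissible_weight \<theta> (skeleton R)"
    "k \<in> {1..length R}" "l \<in> {1..length R}"
    "\<forall>j\<in>{1..length R} - {k}. height \<theta> (skeleton R) j < height \<theta> (skeleton R) k"
    "\<forall>j\<in>{1..length R} - {l}. height \<theta> (skeleton R) j > height \<theta> (skeleton R) l"
    "fst (skeleton R ! (k - 1)) \<noteq> fst (skeleton R ! (k mod length R))"
    "fst (skeleton R ! (l - 1)) \<noteq> fst (skeleton R ! (l mod length R))"
    unfolding M_presentation_def unique_max_min_def len by blast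
  have closed: "word_height \<theta> R = 0"
    using *(1) height_skeleton[of "length R" R \<theta>] by (simp add: admissible_weight_def len)
  show ?thesis
  proof (rule that[of \<theta> "k - 1" "l - 1"])
    fix s assume s: "s < length R"
    show "s \<noteq> k - 1 \<Longrightarrow> fst (R ! s) = fst (R ! (k - 1)) \<Longrightarrow>
        edge_origin \<theta> R s < edge_origin \<theta> R (k - 1)"
      using unique_top_letter[OF signs closed *(2,4,6) s] by blast
    have "\<forall>j\<in>{1..length R} - {l}.
        height (\<lambda>x. - \<theta> x) (skeleton R) j < height (\<lambda>x. - \<theta> x) (skeleton R) l"
      using *(5) by (simp add: height_uminus)
    then show "s \<noteq> l - 1 \<Longrightarrow> fst (R ! s) = fst (R ! (l - 1)) \<Longrightarrow>
        edge_origin \<theta> R s > edge_origin \<theta> R (l - 1)"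
      using unique_top_letter[OF signs _ *(3) _ *(7) s, of "\<lambda>x. - \<theta> x"] closed
      by (simp add: word_height_uminus edge_origin_uminus)
  qed (use * closed in auto)
qed

section \<open>Solving for the labels of the extremal letters\<close>

text \<open>The labels of the top letter \<open>a\<close> are the unknowns \<open>u\<close>. If the bottom letter \<open>b\<close> is
  different, its labels are tied to the same unknowns, shifted so far that the topmost
  unknown still comes from \<open>a\<close> and the bottommost one from \<open>b\<close>.\<close>

locale max_min_word =
  fixes Xs :: "'x set" and H :: "('h, 'c) monoid_scheme" and R :: "('x \<times> int \<times> 'h) list"
    and \<theta> :: "'x \<Rightarrow> int" and a b :: 'x and \<alpha> \<beta> w :: int and s0 s1 :: nat
  assumes H: "group H"
    and letters: "\<forall>(x, e, h)\<in>set R. x \<in> Xs \<and> (e = 1 \<or> e = -1) \<and> h \<in> carrier H"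
    and closed: "word_height \<theta> R = 0"
    and s0: "s0 < length R" "fst (R ! s0) \<in> {a, b}"
    and s1: "s1 < length R" "fst (R ! s1) \<in> {a, b}"
    and ab: "a \<in> Xs" "b \<in> Xs"
    and window: "\<And>s. s < length R \<Longrightarrow> fst (R ! s) \<in> {a, b} \<Longrightarrow>
      edge_origin \<theta> R s + (if fst (R ! s) = a then \<alpha> else \<beta>) \<in> {0..w}"
    and top_iff: "\<And>s. s < length R \<Longrightarrow> fst (R ! s) \<in> {a, b} \<Longrightarrow>
      edge_origin \<theta> R s + (if fst (R ! s) = a then \<alpha> else \<beta>) = w \<longleftrightarrow> s = s0"
    and bottom_iff: "\<And>s. s < length R \<Longrightarrow> fst (R ! s) \<in> {a, b} \<Longrightarrow>
      edge_origin \<theta> R s + (if fst (R ! s) = a then \<alpha> else \<beta>) = 0 \<longleftrightarrow> s = s1"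

lemma max_min_word_exists:
  assumes "M_presentation Xs H R"
  obtains \<theta> a b \<alpha> \<beta> w s0 s1 where "max_min_word Xs H R \<theta> a b \<alpha> \<beta> w s0 s1"
proof -
  obtain \<theta> s0 s1 where ext: "word_height \<theta> R = 0" "s0 < length R" "s1 < length R"
    "\<And>s. s < length R \<Longrightarrow> s \<noteq> s0 \<Longrightarrow> fst (R ! s) = fst (R ! s0) \<Longrightarrow>
      edge_origin \<theta> R s < edge_origin \<theta> R s0"
    "\<And>s. s < length R \<Longrightarrow> s \<noteq> s1 \<Longrightarrow> fst (R ! s) = fst (R ! s1) \<Longrightarrow>
      edge_origin \<theta> R s > edge_origin \<theta> R s1"
    using extremal_letters[OF assms] by metis
  have H: "group H" and
    letters: "\<forall>(x, e, h)\<in>set R. x \<in> Xs \<and> (e = 1 \<or> e = -1) \<and> h \<in> carrier H"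
    using assms by (auto simp: M_presentation_def relative_presentation_def)
  let ?o = "edge_origin \<theta> R"
  define C where "C = (\<Sum>s<length R. \<bar>?o s\<bar>)"
  have C: "\<bar>?o s\<bar> \<le> C" if "s < length R" for s
    unfolding C_def using that by (intro member_le_sum[of s _ "\<lambda>s. \<bar>?o s\<bar>"]) auto
  have mem: "fst (R ! s) \<in> Xs" if "s < length R" for s
    using letters nth_mem[OF that] by (cases "R ! s") auto
  let ?a = "fst (R ! s0)" and ?b = "fst (R ! s1)"
  \<comment> \<open>With \<open>\<beta>\<close> the edges of the bottom letter occupy positions from
    0 to at most \<open>2 * C\<close>. If the top letter is different, the shift
    \<open>3 * C + 1\<close> puts all of its edges above them.\<close>
  define \<alpha> where "\<alpha> = (if ?a = ?b then - ?o s1 else 3 * C + 1)"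
  define \<beta> where "\<beta> = - ?o s1"
  have top: "?o s \<le> ?o s0" "?o s = ?o s0 \<longleftrightarrow> s = s0" if "s < length R" "fst (R ! s) = ?a" for s
    using ext(4)[OF that(1) _ that(2)] by (cases "s = s0"; force)+
  have bot: "?o s \<ge> ?o s1" "?o s = ?o s1 \<longleftrightarrow> s = s1" if "s < length R" "fst (R ! s) = ?b" for s
    using ext(5)[OF that(1) _ that(2)] by (cases "s = s1"; force)+
  have main: "?o s + (if fst (R ! s) = ?a then \<alpha> else \<beta>) \<in> {0..?o s0 + \<alpha>} \<and>
      (?o s + (if fst (R ! s) = ?a then \<alpha> else \<beta>) = ?o s0 + \<alpha> \<longleftrightarrow> s = s0) \<and>
      (?o s + (if fst (R ! s) = ?a then \<alpha> else \<beta>) = 0 \<longleftrightarrow> s = s1)"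
    if s: "s < length R" "fst (R ! s) \<in> {?a, ?b}" for s
  proof (cases "?a = ?b")
    case True
    then show ?thesis using top[OF s(1)] bot[OF s(1)] s(2) by (auto simp: \<alpha>_def)
  next
    case False
    have "\<bar>?o s\<bar> \<le> C" "\<bar>?o s0\<bar> \<le> C" "\<bar>?o s1\<bar> \<le> C" using C s ext by auto
    then show ?thesis
      using False top[OF s(1)] bot[OF s(1)] s(2) by (auto simp: \<alpha>_def \<beta>_def)
  qed
  have "max_min_word Xs H R \<theta> ?a ?b \<alpha> \<beta> (?o s0 + \<alpha>) s0 s1"
  proof (rule max_min_word.intro)
    fix s assume "s < length R" "fst (R ! s) \<in> {?a, ?b}"
    from main[OF this]
    show "?o s + (if fst (R ! s) = ?a then \<alpha> else \<beta>) \<in> {0..?o s0 + \<alpha>}"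
      and "?o s + (if fst (R ! s) = ?a then \<alpha> else \<beta>) = ?o s0 + \<alpha> \<longleftrightarrow> s = s0"
      and "?o s + (if fst (R ! s) = ?a then \<alpha> else \<beta>) = 0 \<longleftrightarrow> s = s1"
      by blast+
  qed (use H letters ext mem in auto)
  then show ?thesis by (rule that)
qed

context max_min_word
begin

text \<open>The factor \<open>q b i\<close> allows the labels of \<open>b\<close> any values
  relative to the unknowns, so tying \<open>b\<close> to \<open>a\<close> excludes no
  labelling.\<close>

definition labels ::
    "('p, 'd) monoid_scheme \<Rightarrow> ('x \<Rightarrow> int \<Rightarrow> 'p) \<Rightarrow> (int \<Rightarrow> 'p) \<Rightarrow> 'x \<Rightarrow> int \<Rightarrow> 'p"
  where "labels P q u x i =
    (if x = a then u (i + \<alpha>) else if x = b then q x i \<otimes>\<^bsub>P\<^esub> u (i + \<beta>) else q x i)"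

definition solves ::
    "('p, 'd) monoid_scheme \<Rightarrow> (int \<Rightarrow> 'h \<Rightarrow> 'p) \<Rightarrow> ('x \<Rightarrow> int \<Rightarrow> 'p) \<Rightarrow> (int \<Rightarrow> 'p) \<Rightarrow> int
      \<Rightarrow> (int \<Rightarrow> 'p) \<Rightarrow> bool"
  where "solves P lam q z j u \<longleftrightarrow> word_label P \<theta> lam (labels P q u) R j = z j"

definition coefficients ::
    "('p, 'd) monoid_scheme \<Rightarrow> (int \<Rightarrow> 'h \<Rightarrow> 'p) \<Rightarrow> ('x \<Rightarrow> int \<Rightarrow> 'p) \<Rightarrow> (int \<Rightarrow> 'p) \<Rightarrow> bool"
  where "coefficients P lam q z \<longleftrightarrow>
    (\<forall>i. lam i \<in> hom H P \<and> z i \<in> carrier P \<and> (\<forall>x\<in>Xs. q x i \<in> carrier P))"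

lemma letter:
  assumes "s < length R"
  obtains x e h where "R ! s = (x, e, h)" "x \<in> Xs" "e = 1 \<or> e = -1" "h \<in> carrier H"
  using letters nth_mem[OF assms] by (cases "R ! s") auto

lemma labels_closed:
  assumes "group P" "coefficients P lam q z" "range u \<subseteq> carrier P" "x \<in> Xs"
  shows "labels P q u x i \<in> carrier P"
proof -
  interpret group P by fact
  show ?thesis
    using assms(2-4) by (auto simp: labels_def coefficients_def image_subset_iff)
qed

lemma letter_label_closed:
  assumes "group P" "coefficients P lam q z" "range u \<subseteq> carrier P" "s < length R"
  shows "letter_label P \<theta> lam (labels P q u) R j s \<in> carrier P"
proof -
  interpret group P by fact
  obtain x e h where "R ! s = (x, e, h)" "x \<in> Xs" "e = 1 \<or> e = -1" "h \<in> carrier H"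
    by (rule letter[OF assms(4)])
  then show ?thesis
    using labels_closed[OF assms(1-3)] assms(2)
    by (auto simp: letter_label_def coefficients_def hom_def Pi_def)
qed

lemma letter_label_cong:
  assumes "s < length R"
    and "fst (R ! s) \<in> {a, b} \<Longrightarrow>
      u (j + (edge_origin \<theta> R s + (if fst (R ! s) = a then \<alpha> else \<beta>))) =
      v (j + (edge_origin \<theta> R s + (if fst (R ! s) = a then \<alpha> else \<beta>)))"
  shows "letter_label P \<theta> lam (labels P q u) R j s = letter_label P \<theta> lam (labels P q v) R j s"
proof -
  obtain x e h where s: "R ! s = (x, e, h)" by (rule letter[OF assms(1)])
  have "labels P q u x (j + edge_origin \<theta> R s) = labels P q v x (j + edge_origin \<theta> R s)"
    using assms(2) s by (auto simp: labels_def add.assoc)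
  then show ?thesis by (simp add: letter_label_def s)
qed

lemma word_label_cong:
  assumes "\<And>s. s < length R \<Longrightarrow> letter_label P \<theta> lam Y R j s = letter_label P \<theta> lam' Y' R j' s"
  shows "word_label P \<theta> lam Y R j = word_label P \<theta> lam' Y' R j'"
  unfolding word_label_conv_letters using assms by (auto intro!: arg_cong2[of _ _ _ _ "foldr _"] map_cong)

text \<open>Letter \<open>s\<close> is the only one that reads the unknown at \<open>j + t\<close>;
  all other factors are constants, so the unknown can be isolated.\<close>

lemma solve_one_letter:
  assumes P: "group P" "coefficients P lam q z" "range u \<subseteq> carrier P"
    and s: "s < length R" "fst (R ! s) \<in> {a, b}"
    and only: "\<And>s'. s' < length R \<Longrightarrow> fst (R ! s') \<in> {a, b} \<Longrightarrow>
      edge_origin \<theta> R s' + (if fst (R ! s') = a then \<alpha> else \<beta>) = t \<longleftrightarrow> s' = s"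
  shows "\<exists>!p. p \<in> carrier P \<and> solves P lam q z j (u(j + t := p))"
proof -
  interpret group P by fact
  let ?L = "\<lambda>p. letter_label P \<theta> lam (labels P q (u(j + t := p))) R j"
  let ?M = "letter_label P \<theta> lam (labels P q u) R j"
  have other: "?L p s' = ?M s'" if "s' < length R" "s' \<noteq> s" for p s'
    using that only[of s'] by (intro letter_label_cong) auto
  obtain x e h where xeh: "R ! s = (x, e, h)" "x \<in> Xs" "e = 1 \<or> e = -1" "h \<in> carrier H"
    by (rule letter[OF s(1)])
  \<comment> \<open>The label of \<open>a\<close> is the bare unknown, that of \<open>b\<close>
    carries the parameter in front.\<close>
  define c where "c = (if x = a then \<one>\<^bsub>P\<^esub> else q x (j + edge_origin \<theta> R s))"
  define d where "d = lam (j + word_height \<theta> (take (Suc s) R)) h"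
  have cd: "c \<in> carrier P" "d \<in> carrier P"
    using P(2) xeh by (auto simp: c_def d_def coefficients_def hom_def)
  have Ls: "?L p s = (if e = 1 then c \<otimes>\<^bsub>P\<^esub> p else inv\<^bsub>P\<^esub> (c \<otimes>\<^bsub>P\<^esub> p)) \<otimes>\<^bsub>P\<^esub> d"
    if "p \<in> carrier P" for p
    using only[OF s] s(2) xeh(1) that
    by (auto simp: letter_label_def labels_def c_def d_def add.assoc)
  let ?A = "foldr (\<otimes>\<^bsub>P\<^esub>) (map ?M [0..<s]) \<one>\<^bsub>P\<^esub>"
  let ?B = "foldr (\<otimes>\<^bsub>P\<^esub>) (map ?M [Suc s..<length R]) \<one>\<^bsub>P\<^esub>"
  have cl: "set (map ?M [0..<s]) \<subseteq> carrier P" "set (map ?M [Suc s..<length R]) \<subseteq> carrier P"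
    using letter_label_closed[OF P] s(1) by auto
  have AB: "?A \<in> carrier P" "?B \<in> carrier P"
    using foldr_mult_append(2)[OF _ cl(1), of "[]"] foldr_mult_append(2)[OF _ cl(2), of "[]"] by auto
  have split: "[0..<length R] = [0..<s] @ s # [Suc s..<length R]"
    using s(1) upt_add_eq_append[of 0 s "length R - s"] by (simp add: upt_conv_Cons)
  have lab: "word_label P \<theta> lam (labels P q (u(j + t := p))) R j =
      ?A \<otimes>\<^bsub>P\<^esub> ((if e = 1 then c \<otimes>\<^bsub>P\<^esub> p else inv\<^bsub>P\<^esub> (c \<otimes>\<^bsub>P\<^esub> p)) \<otimes>\<^bsub>P\<^esub> d) \<otimes>\<^bsub>P\<^esub> ?B"
    if p: "p \<in> carrier P" for p
  proof -
    have m: "map (?L p) [0..<length R] = map ?M [0..<s] @ ?L p s # map ?M [Suc s..<length R]"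
      using other s(1) by (simp add: split)
    have Lc: "?L p s \<in> carrier P" using Ls[OF p] cd p by simp
    have "word_label P \<theta> lam (labels P q (u(j + t := p))) R j = ?A \<otimes>\<^bsub>P\<^esub> (?L p s \<otimes>\<^bsub>P\<^esub> ?B)"
      unfolding word_label_conv_letters m
      using foldr_mult_append(1)[OF cl(1), of "?L p s # map ?M [Suc s..<length R]"] cl Lc by simp
    then show ?thesis using Ls[OF p] Lc AB by (simp add: m_assoc)
  qed
  have "z j \<in> carrier P" using P(2) by (simp add: coefficients_def)
  from unique_factor[OF AB cd this, of "e = 1"]
  show ?thesis unfolding solves_def using lab by (metis (no_types, lifting))
qed

lemma recurrence:
  assumes P: "group P" "coefficients P lam q z"
  shows "reversible_recurrence w (carrier P) (solves P lam q z)"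
proof
  show "0 \<le> w" using window[OF s0] by simp
  show "solves P lam q z j u \<longleftrightarrow> solves P lam q z j v"
    if "\<And>i. j \<le> i \<Longrightarrow> i \<le> j + w \<Longrightarrow> u i = v i" for j u v
  proof -
    have "letter_label P \<theta> lam (labels P q u) R j s = letter_label P \<theta> lam (labels P q v) R j s"
      if s: "s < length R" for s
    proof (rule letter_label_cong[OF s])
      assume "fst (R ! s) \<in> {a, b}"
      from window[OF s this]
      show "u (j + (edge_origin \<theta> R s + (if fst (R ! s) = a then \<alpha> else \<beta>))) =
          v (j + (edge_origin \<theta> R s + (if fst (R ! s) = a then \<alpha> else \<beta>)))"
        by (intro \<open>\<And>i. j \<le> i \<Longrightarrow> i \<le> j + w \<Longrightarrow> u i = v i\<close>) auto
    qed
    then show ?thesis unfolding solves_def by (metis word_label_cong)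
  qed
  show "\<exists>!p. p \<in> carrier P \<and> solves P lam q z j (u(j + w := p))" if "range u \<subseteq> carrier P" for j u
    using solve_one_letter[OF P that s0 top_iff] .
  show "\<exists>!p. p \<in> carrier P \<and> solves P lam q z j (u(j := p))" if "range u \<subseteq> carrier P" for j u
    using solve_one_letter[OF P that s1 bottom_iff, of j] by simp
qed

text \<open>Agreement is required only at the places that equation \<open>j\<close> reads, so the
  lemma still applies after the coefficients are changed elsewhere.\<close>

lemma solves_hom:
  assumes P: "group K" "group P" "\<psi> \<in> hom K P" "coefficients K lam q z" "range u \<subseteq> carrier K"
    and agree: "\<And>s h. s < length R \<Longrightarrow> h \<in> carrier H \<Longrightarrow>
        lam' (j + word_height \<theta> (take (Suc s) R)) h = \<psi> (lam (j + word_height \<theta> (take (Suc s) R)) h)"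
      "\<And>s x. s < length R \<Longrightarrow> x \<in> Xs \<Longrightarrow>
        q' x (j + edge_origin \<theta> R s) = \<psi> (q x (j + edge_origin \<theta> R s))"
      "z' j = \<psi> (z j)"
    and sol: "solves K lam q z j u"
  shows "solves P lam' q' z' j (\<psi> \<circ> u)"
proof -
  interpret \<psi>: group_hom K P \<psi>
    using P by (simp add: group_hom_def group_hom_axioms_def)
  have "letter_label P \<theta> lam' (labels P q' (\<psi> \<circ> u)) R j s = \<psi> (letter_label K \<theta> lam (labels K q u) R j s)"
    if s: "s < length R" for s
  proof -
    obtain x e h where xeh: "R ! s = (x, e, h)" "x \<in> Xs" "e = 1 \<or> e = -1" "h \<in> carrier H"
      by (rule letter[OF s])
    have "labels P q' (\<psi> \<circ> u) x (j + edge_origin \<theta> R s) = \<psi> (labels K q u x (j + edge_origin \<theta> R s))"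
      using agree(2)[OF s xeh(2)] P(4,5) xeh(2)
      by (auto simp: labels_def coefficients_def image_subset_iff)
    moreover have "lam (j + word_height \<theta> (take (Suc s) R)) h \<in> carrier K"
      using P(4) xeh(4) by (auto simp: coefficients_def hom_def)
    moreover note labels_closed[OF P(1,4,5) xeh(2), of "j + edge_origin \<theta> R s"]
    ultimately show ?thesis
      using agree(1)[OF s xeh(4)] by (simp add: letter_label_def xeh(1))
  qed
  then have m: "map (letter_label P \<theta> lam' (labels P q' (\<psi> \<circ> u)) R j) [0..<length R] =
      map \<psi> (map (letter_label K \<theta> lam (labels K q u) R j) [0..<length R])" by simp
  have f: "foldr (\<otimes>\<^bsub>P\<^esub>) (map \<psi> xs) \<one>\<^bsub>P\<^esub> = \<psi> (foldr (\<otimes>\<^bsub>K\<^esub>) xs \<one>\<^bsub>K\<^esub>)" if "set xs \<subseteq> carrier K" for xs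
    using that
  proof (induction xs)
    case (Cons x xs)
    then show ?case using \<psi>.G.foldr_mult_append(2)[of "[]" xs] by simp
  qed simp
  have "set (map (letter_label K \<theta> lam (labels K q u) R j) [0..<length R]) \<subseteq> carrier K"
    using letter_label_closed[OF P(1,4,5)] by auto
  from f[OF this] show ?thesis
    using sol agree(3) unfolding solves_def word_label_conv_letters m by simp
qed

end

section \<open>Finite quotients of the presented groups\<close>

lemma normal_closure_subset_kernel:
  assumes "group A" "group P" "\<Psi> \<in> hom A P" "w \<in> carrier A" "\<Psi> w = \<one>\<^bsub>P\<^esub>"
  shows "normal_closure A {w} \<subseteq> kernel A P \<Psi>"
proof -
  interpret group_hom A P \<Psi>
    using assms by (simp add: group_hom_def group_hom_axioms_def)
  have "{w} \<subseteq> kernel A P \<Psi>" using assms by (simp add: kernel_def)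
  then show ?thesis using normal_kernel unfolding normal_closure_def by blast
qed

lemma residually_finite_presented_group:
  assumes H: "group H" and w: "w \<in> carrier (ambient_group Xs H)"
    and sep: "\<And>g. g \<in> carrier (ambient_group Xs H) \<Longrightarrow>
      g \<notin> normal_closure (ambient_group Xs H) {w} \<Longrightarrow>
      \<exists>N. N \<lhd> ambient_group Xs H \<and> finite (carrier (ambient_group Xs H Mod N)) \<and> w \<in> N \<and> g \<notin> N"
  shows "residually_finite (presented_group Xs H w)"
  unfolding residually_finite_def
proof (intro conjI ballI impI)
  let ?A = "ambient_group Xs H" and ?G = "presented_group Xs H w"
  let ?C = "normal_closure ?A {w}"
  show G: "group ?G" by (rule group_presented_group[OF H w])
  interpret A: group ?A by (rule group_ambient_group[OF H])
  interpret C: normal ?C ?A using w by (intro A.normal_closure_normal) simp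
  fix X assume X: "X \<in> carrier ?G" "X \<noteq> \<one>\<^bsub>?G\<^esub>"
  obtain g where g: "g \<in> carrier ?A" "X = ?C #>\<^bsub>?A\<^esub> g"
    using X(1) by (auto simp: presented_group_def FactGroup_def RCOSETS_def)
  have "g \<notin> ?C" using X(2) g A.coset_join2[OF g(1) C.subgroup_axioms]
    by (auto simp: presented_group_def FactGroup_def)
  then obtain N where N: "N \<lhd> ?A" "finite (carrier (?A Mod N))" "w \<in> N" "g \<notin> N"
    using sep[OF g(1)] by blast
  interpret N: normal N ?A by fact
  interpret p: group_hom ?A "?A Mod N" "(#>\<^bsub>?A\<^esub>) N"
    using N.r_coset_hom_Mod N.factorgroup_is_group by (simp add: group_hom_def group_hom_axioms_def)
  have ker: "y \<in> kernel ?A (?A Mod N) ((#>\<^bsub>?A\<^esub>) N) \<longleftrightarrow> y \<in> N" if "y \<in> carrier ?A" for y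
    using that A.rcos_self[OF that N.subgroup_axioms] A.coset_join2[OF that N.subgroup_axioms]
    by (auto simp: kernel_def FactGroup_def)
  have "?C \<subseteq> N"
    using N(1,3) unfolding normal_closure_def by blast
  then have "?C \<subseteq> kernel ?A (?A Mod N) ((#>\<^bsub>?A\<^esub>) N)"
    using ker C.subset by blast
  then obtain f where f: "f \<in> hom (?A Mod ?C) (?A Mod N)"
    "\<And>x. x \<in> carrier ?A \<Longrightarrow> f (?C #>\<^bsub>?A\<^esub> x) = N #>\<^bsub>?A\<^esub> x"
    using p.FactGroup_universal_kernel[OF C.normal_axioms] by blast
  have "f X \<noteq> \<one>\<^bsub>?A Mod N\<^esub>"
    using f(2)[OF g(1)] g ker[OF g(1)] N(4) by (simp add: kernel_def)
  then show "\<exists>N. N \<lhd> ?G \<and> finite (carrier (?G Mod N)) \<and> X \<notin> N"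
    using finite_index_kernel[OF G N.factorgroup_is_group N(2) _ X(1), of f] f(1)
    by (simp add: presented_group_def)
qed

text \<open>The coefficient group \<open>H\<close> embeds in the presented group: with \<open>P = H\<close> and trivial
  coefficients the recurrence can be solved, and \<open>H\<close> acts faithfully.\<close>

lemma residually_finite_coefficient_group:
  assumes M: "M_presentation Xs H R"
    and G: "residually_finite (presented_group Xs H (relator Xs H R))"
  shows "residually_finite H"
proof -
  obtain \<theta> a b \<alpha> \<beta> w s0 s1 where "max_min_word Xs H R \<theta> a b \<alpha> \<beta> w s0 s1"
    by (rule max_min_word_exists[OF M])
  then interpret max_min_word Xs H R \<theta> a b \<alpha> \<beta> w s0 s1 .
  interpret H: group H by (rule H)
  let ?A = "ambient_group Xs H" and ?r = "relator Xs H R"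
  interpret A: group ?A by (rule group_ambient_group[OF H])
  \<comment> \<open>The values 1 in \<open>?z\<close> make every V_j trivial, so \<open>R\<close>
    itself is killed and not just a power of it.\<close>
  let ?lam = "\<lambda>_::int. id" and ?q = "\<lambda>(_::'x) (_::int). \<one>\<^bsub>H\<^esub>" and ?z = "\<lambda>_::int. \<one>\<^bsub>H\<^esub>"
  have co: "coefficients H ?lam ?q ?z" by (auto simp: coefficients_def hom_def)
  interpret rr: reversible_recurrence w "carrier H" "solves H ?lam ?q ?z" by (rule recurrence[OF H co])
  have "range (\<lambda>_::int. \<one>\<^bsub>H\<^esub>) \<subseteq> carrier H" by auto
  from rr.solution_exists[OF this]
  obtain u where u: "range u \<subseteq> carrier H" "\<And>j. solves H ?lam ?q ?z j u"
    by blast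
  have "labelling Xs H H 0 ?lam (labels H ?q u)"
    using labels_closed[OF H co u(1)] by (auto simp: labelling_def hom_def)
  then obtain \<Psi> where \<Psi>: "represents Xs H H \<theta> 0 ?lam (labels H ?q u) \<Psi>"
    using labelling_represents[OF H H] by blast
  have r: "?r \<in> carrier ?A" "\<Psi> ?r = (word_label H \<theta> ?lam (labels H ?q u) R, 0)"
    using represents_relator[OF H H \<Psi> letters] closed by auto
  have "\<Psi> ?r = \<one>\<^bsub>shift_wreath H 0\<^esub>"
    using u(2) r(2) by (auto simp: shift_wreath_def solves_def)
  then have ker: "normal_closure ?A {?r} \<subseteq> kernel ?A (shift_wreath H 0) \<Psi>"
    using \<Psi> r(1) by (intro normal_closure_subset_kernel A.group_axioms group_shift_wreath H)
      (simp_all add: represents_def)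
  let ?C = "normal_closure ?A {?r}"
  interpret C: normal ?C ?A using r(1) by (intro A.normal_closure_normal) simp
  show ?thesis
  proof (rule residually_finite_of_separating_homs[OF H _ G])
    fix h assume h: "h \<in> carrier H" "h \<noteq> \<one>\<^bsub>H\<^esub>"
    let ?i = "free_product_inl H (free_group Xs)"
    have hom: "(#>\<^bsub>?A\<^esub>) ?C \<circ> ?i \<in> hom H (presented_group Xs H ?r)"
      unfolding presented_group_def
      by (rule hom_compose[OF free_product_inl_hom C.r_coset_hom_Mod]) (rule H.is_monoid)
    have "\<Psi> (?i h) \<noteq> \<one>\<^bsub>shift_wreath H 0\<^esub>"
      using \<Psi> h by (auto simp: represents_def shift_wreath_def fun_eq_iff)
    then have "?i h \<notin> ?C" using ker by (auto simp: kernel_def)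
    moreover have "?i h \<in> ?C #>\<^bsub>?A\<^esub> ?i h"
      using h H by (intro A.rcos_self C.subgroup_axioms) simp
    ultimately have "(?C #>\<^bsub>?A\<^esub> ?i h) \<noteq> \<one>\<^bsub>presented_group Xs H ?r\<^esub>"
      by (auto simp: presented_group_def FactGroup_def)
    then show "\<exists>\<phi>\<in>hom H (presented_group Xs H ?r). \<phi> h \<noteq> \<one>\<^bsub>presented_group Xs H ?r\<^esub>"
      using hom by auto
  qed
qed

text \<open>Indices of the free factors: \<open>Loop i\<close> for a copy of \<open>H\<close> giving
  the loops at \<open>i\<close>, \<open>Value i\<close> for an element of order dividing
  \<open>n\<close> prescribed as V_i, \<open>Edge x i\<close> for an infinite cyclic
  parameter.\<close>

datatype 'x position = Loop int | Value int | Edge 'x int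

lemma (in group) int_pow_mod:
  assumes "x \<in> carrier G" "x [^] n = \<one>"
  shows "x [^] (k mod int n) = x [^] k"
proof -
  have "x [^] (int n * (k div int n)) = (x [^] int n) [^] (k div int n)"
    using assms(1) by (simp add: int_pow_pow)
  also have "\<dots> = \<one>" using assms by (simp add: int_pow_int)
  finally have "x [^] (int n * (k div int n)) \<otimes> x [^] (k mod int n) = x [^] (k mod int n)"
    using assms(1) by simp
  moreover have "x [^] k = x [^] (int n * (k div int n)) \<otimes> x [^] (k mod int n)"
    by (simp add: assms(1) flip: int_pow_mult)
  ultimately show ?thesis by simp
qed

text \<open>All factors of the free product are the same group \<open>H \<times> \<int> \<times> \<int>/n\<close>, of which each factor
  only uses one component.\<close>

lemma universal_coefficients:
  fixes H :: "('h, 'c) monoid_scheme" and L :: "('l, 'd) monoid_scheme"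
    and c :: "'x \<Rightarrow> int \<Rightarrow> 'l" and \<phi> :: "int \<Rightarrow> 'h \<Rightarrow> 'l" and r :: "int \<Rightarrow> 'l"
  assumes rf: "residually_finite H" and n: "n > 1" and L: "group L"
    and \<phi>: "\<And>i. \<phi> i \<in> hom H L" and c: "\<And>x i. c x i \<in> carrier L"
    and r: "\<And>i. r i \<in> carrier L" "\<And>i. r i [^]\<^bsub>L\<^esub> (n::nat) = \<one>\<^bsub>L\<^esub>"
  obtains K :: "('x position \<times> 'h \<times> int \<times> int) list set monoid" and lam q z \<rho> where
    "residually_finite K" "\<forall>i. lam i \<in> hom H K" "\<forall>x i. q x i \<in> carrier K"
    "\<forall>i. z i \<in> carrier K \<and> z i [^]\<^bsub>K\<^esub> n = \<one>\<^bsub>K\<^esub>" "\<rho> \<in> hom K L"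
    "\<forall>i. \<forall>h\<in>carrier H. \<rho> (lam i h) = \<phi> i h" "\<forall>x i. \<rho> (q x i) = c x i" "\<forall>i. \<rho> (z i) = r i"
proof -
  interpret H: group H using rf by (simp add: residually_finite_def)
  interpret L: group L by fact
  define D where "D = H \<times>\<times> (integer_group \<times>\<times> integer_mod_group n)"
  have Drf: "residually_finite D"
    unfolding D_def using n
    by (intro residually_finite_DirProd rf residually_finite_integer_group)
      (simp add: residually_finite_if_finite carrier_integer_mod_group)
  then have D: "group D" by (simp add: residually_finite_def)
  define G where "G = (\<lambda>_ :: 'x position. D)"
  define K where "K = family_product G"
  have Krf: "residually_finite K"
    unfolding K_def G_def by (rule residually_finite_family_product) (rule Drf)
  then interpret K: group K by (simp add: residually_finite_def)
  let ?i = "family_inj G"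
  have inj: "?i j \<in> hom D K" for j
    using family_inj_hom[of G j] D by (simp add: G_def K_def group.is_monoid)
  define lam where "lam i h = ?i (Loop i) (h, 0, 0)" for i h
  define q where "q x i = ?i (Edge x i) (\<one>\<^bsub>H\<^esub>, 1, 0)" for x i
  define z where "z i = ?i (Value i) (\<one>\<^bsub>H\<^esub>, 0, 1)" for i
  have inD: "(h, 0, 0) \<in> carrier D" "(\<one>\<^bsub>H\<^esub>, 1, 0) \<in> carrier D" "(\<one>\<^bsub>H\<^esub>, 0, 1) \<in> carrier D"
    if "h \<in> carrier H" for h
    using that n by (auto simp: D_def)
  have lam: "lam i \<in> hom H K" for i
  proof -
    have "(\<lambda>h. (h, 0, 0)) \<in> hom H D" by (auto simp: D_def hom_def)
    from hom_compose[OF this inj] show ?thesis by (simp add: lam_def[abs_def] comp_def)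
  qed
  have q: "q x i \<in> carrier K" for x i
    using inj inD[OF H.one_closed] by (auto simp: q_def hom_def)
  have z: "z i \<in> carrier K" for i
    using inj inD[OF H.one_closed] by (auto simp: z_def hom_def)
  have zn: "z i [^]\<^bsub>K\<^esub> n = \<one>\<^bsub>K\<^esub>" for i
  proof -
    let ?Z = "integer_mod_group n"
    have "(\<lambda>k. (\<one>\<^bsub>H\<^esub>, 0, k)) \<in> hom ?Z D" by (auto simp: D_def hom_def)
    from hom_compose[OF this inj[of "Value i"]]
    interpret Z: group_hom ?Z K "\<lambda>k. ?i (Value i) (\<one>\<^bsub>H\<^esub>, 0, k)"
      by (simp add: group_hom_def group_hom_axioms_def K.group_axioms comp_def)
    show ?thesis
      using Z.hom_nat_pow[of 1 n] Z.hom_one n by (simp add: z_def)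
  qed
  \<comment> \<open>Each factor is mapped through the one component it serves; on
    \<open>Value i\<close> this respects addition modulo \<open>n\<close> because the
    \<open>n\<close>-th power of \<open>r i\<close> is 1.\<close>
  define f :: "'x position \<Rightarrow> 'h \<times> int \<times> int \<Rightarrow> 'l"
    where "f j = (case j of Loop i \<Rightarrow> \<phi> i \<circ> fst | Value i \<Rightarrow> (\<lambda>d. r i [^]\<^bsub>L\<^esub> snd (snd d))
      | Edge x i \<Rightarrow> (\<lambda>d. c x i [^]\<^bsub>L\<^esub> fst (snd d)))" for j
  have "f j \<in> hom (G j) L" for j
  proof (cases j)
    case (Loop i)
    then show ?thesis using \<phi>[of i] by (auto simp: f_def G_def D_def hom_def)
  next
    case (Value i)
    then show ?thesis
      using r by (auto simp: f_def G_def D_def hom_def L.int_pow_mod L.int_pow_mult)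
  next
    case (Edge x i)
    then show ?thesis
      using c by (auto simp: f_def G_def D_def hom_def L.int_pow_mult)
  qed
  then obtain \<rho> where \<rho>: "\<rho> \<in> hom K L" "\<And>j d. d \<in> carrier D \<Longrightarrow> \<rho> (?i j d) = f j d"
    using family_product_hom_exists[of L f G] L D unfolding K_def G_def by blast
  show ?thesis
  proof (rule that[OF Krf _ _ _ \<rho>(1)])
    show "\<forall>i. lam i \<in> hom H K" "\<forall>x i. q x i \<in> carrier K"
      "\<forall>i. z i \<in> carrier K \<and> z i [^]\<^bsub>K\<^esub> n = \<one>\<^bsub>K\<^esub>"
      using lam q z zn by blast+
    show "\<forall>i. \<forall>h\<in>carrier H. \<rho> (lam i h) = \<phi> i h"
      using inD(1) by (simp add: lam_def \<rho>(2) f_def)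
    show "\<forall>x i. \<rho> (q x i) = c x i"
      using inD(2)[OF H.one_closed] c by (simp add: q_def \<rho>(2) f_def)
    show "\<forall>i. \<rho> (z i) = r i"
      using inD(3)[OF H.one_closed] r by (simp add: z_def \<rho>(2) f_def)
  qed
qed

section \<open>Periodic labellings and powers of the relator\<close>

context max_min_word
begin

text \<open>The period \<open>N\<close> is known only at the end: the coefficients get period
  \<open>M\<close>, and the solution they determine has some multiple of \<open>M\<close> as
  period.\<close>

lemma periodic_finite_quotient:
  assumes K: "residually_finite K" and co: "coefficients K lam q z"
    and zn: "\<And>i. z i [^]\<^bsub>K\<^esub> (n::nat) = \<one>\<^bsub>K\<^esub>"
    and u: "range u \<subseteq> carrier K" "\<And>j. solves K lam q z j u"
    and \<Psi>: "represents Xs H K \<theta> 0 lam (labels K q u) \<Psi>"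
    and g: "g \<in> carrier (ambient_group Xs H)" "fst (\<Psi> g) 0 \<noteq> \<one>\<^bsub>K\<^esub>"
  shows "\<exists>N. N \<lhd> ambient_group Xs H \<and> finite (carrier (ambient_group Xs H Mod N)) \<and>
    relator Xs H R [^]\<^bsub>ambient_group Xs H\<^esub> n \<in> N \<and> g \<notin> N"
proof -
  let ?A = "ambient_group Xs H" and ?r = "relator Xs H R"
  interpret A: group ?A by (rule group_ambient_group[OF H])
  interpret K: group K using K by (simp add: residually_finite_def)
  note gK = K.group_axioms
  have \<Psi>g: "fst (\<Psi> g) 0 \<in> carrier K" by (rule represents_periodic(3)[OF \<Psi> g(1)])
  obtain N0 where N0: "N0 \<lhd> K" "group (K Mod N0)" "finite (carrier (K Mod N0))"
    "(#>\<^bsub>K\<^esub>) N0 \<in> hom K (K Mod N0)" "N0 #>\<^bsub>K\<^esub> fst (\<Psi> g) 0 \<noteq> \<one>\<^bsub>K Mod N0\<^esub>"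
    by (rule residually_finite_quotient[OF K \<Psi>g g(2)])
  define P where "P = K Mod N0"
  define \<psi> where "\<psi> = (#>\<^bsub>K\<^esub>) N0"
  have P: "group P" "finite (carrier P)" "\<psi> \<in> hom K P" "\<psi> (fst (\<Psi> g) 0) \<noteq> \<one>\<^bsub>P\<^esub>"
    using N0 by (simp_all add: P_def \<psi>_def)
  interpret \<psi>: group_hom K P \<psi>
    using P gK by (simp add: group_hom_def group_hom_axioms_def)
  obtain B0 where B0_all: "\<forall>N lam' Y' \<Psi>'. represents Xs H P \<theta> N lam' Y' \<Psi>' \<longrightarrow>
      (\<forall>i. \<bar>i\<bar> \<le> B0 \<longrightarrow> (\<forall>h\<in>carrier H. lam' i h = \<psi> (lam i h)) \<and>
        (\<forall>x\<in>Xs. Y' x i = \<psi> (labels K q u x i))) \<longrightarrow>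
      fst (\<Psi>' g) 0 = \<psi> (fst (\<Psi> g) 0)"
    using represents_local[OF H gK P(1,3) \<Psi> g(1), of 0] by blast
  have B0: "fst (\<Psi>' g) 0 = \<psi> (fst (\<Psi> g) 0)"
    if "represents Xs H P \<theta> N lam' Y' \<Psi>'"
      "\<And>i h. \<bar>i\<bar> \<le> B0 \<Longrightarrow> h \<in> carrier H \<Longrightarrow> lam' i h = \<psi> (lam i h)"
      "\<And>i x. \<bar>i\<bar> \<le> B0 \<Longrightarrow> x \<in> Xs \<Longrightarrow> Y' x i = \<psi> (labels K q u x i)" for N lam' Y' \<Psi>'
    using B0_all[rule_format, OF that(1)] that(2,3) by blast
  \<comment> \<open>Equation \<open>j\<close> reads coefficients at distance at most
    \<open>C\<close> from \<open>j\<close>.\<close>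
  define C where "C = (\<Sum>s<length R. \<bar>edge_origin \<theta> R s\<bar> + \<bar>word_height \<theta> (take (Suc s) R)\<bar>)"
  have C: "\<bar>edge_origin \<theta> R s\<bar> + \<bar>word_height \<theta> (take (Suc s) R)\<bar> \<le> C" if "s < length R" for s
    unfolding C_def using that
    by (intro member_le_sum[of s _ "\<lambda>s. \<bar>edge_origin \<theta> R s\<bar> + \<bar>word_height \<theta> (take (Suc s) R)\<bar>"]) auto
  have C0: "C \<ge> 0" unfolding C_def by (intro sum_nonneg) auto
  \<comment> \<open>\<open>g\<close> reads labels up to \<open>B0\<close>, hence unknowns up to
    \<open>b\<close>. Comparing these takes the equations up to \<open>b\<close>, whose coefficients
    lie within \<open>B\<close>. The interval from \<open>- B\<close> to \<open>B\<close> is one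
    period of length \<open>M\<close>, and \<open>per\<close> picks representatives in it.\<close>
  define b where "b = \<bar>B0\<bar> + \<bar>\<alpha>\<bar> + \<bar>\<beta>\<bar>"
  define B where "B = b + C"
  define M where "M = 2 * B + 1"
  have "B \<ge> 0" "M > 0" using C0 by (auto simp: B_def M_def b_def)
  define per where "per i = (i + B) mod M - B" for i
  have per: "per i = i" if "\<bar>i\<bar> \<le> B" for i
    using that by (simp add: per_def M_def mod_pos_pos_trivial)
  have perM: "per (i + k * M) = per i" for i k
  proof -
    have "i + k * M + B = (i + B) + k * M" by simp
    then show ?thesis unfolding per_def by (simp only: mod_mult_self1)
  qed
  define lamP where "lamP i = \<psi> \<circ> lam (per i)" for i
  define qP where "qP x i = \<psi> (q x (per i))" for x i
  define zP where "zP i = \<psi> (z (per i))" for i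
  have coP: "coefficients P lamP qP zP"
    using co hom_compose[OF _ P(3)] by (auto simp: coefficients_def lamP_def qP_def zP_def)
  interpret r: reversible_recurrence w "carrier P" "solves P lamP qP zP"
    by (rule recurrence[OF P(1) coP])
  have \<psi>u: "range (\<psi> \<circ> u) \<subseteq> carrier P" using u(1) by (auto simp: image_subset_iff)
  obtain v where v: "range v \<subseteq> carrier P" "\<And>i. 0 \<le> i \<Longrightarrow> i < w \<Longrightarrow> v i = \<psi> (u i)"
    "\<And>j. solves P lamP qP zP j v"
    using r.solution_exists[OF \<psi>u] by (auto simp: comp_def)
  have \<psi>sol: "solves P lamP qP zP j (\<psi> \<circ> u)" if j: "\<bar>j\<bar> \<le> b" for j
  proof (rule solves_hom[OF gK P(1,3) co u(1) _ _ _ u(2)])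
    fix s assume "s < length R"
    from C[OF this] j
    have "\<bar>j + word_height \<theta> (take (Suc s) R)\<bar> \<le> B" "\<bar>j + edge_origin \<theta> R s\<bar> \<le> B"
      by (auto simp: B_def)
    then show "lamP (j + word_height \<theta> (take (Suc s) R)) h = \<psi> (lam (j + word_height \<theta> (take (Suc s) R)) h)"
      and "qP x (j + edge_origin \<theta> R s) = \<psi> (q x (j + edge_origin \<theta> R s))" for h x
      by (simp_all add: lamP_def qP_def per)
  next
    show "zP j = \<psi> (z j)" using j C0 by (simp add: zP_def per B_def)
  qed
  \<comment> \<open>Both sequences have the same initial window and solve the same equations for
    \<open>\<bar>j\<bar> \<le> b\<close>.\<close>
  have vu: "v i = \<psi> (u i)" if "\<bar>i\<bar> \<le> b" for i
    using r.solution_unique[OF v(1) \<psi>u _ _ that] v \<psi>sol by simp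
  have shift: "solves P lamP qP zP (j + M) v' \<longleftrightarrow> solves P lamP qP zP j (\<lambda>i. v' (i + M))" for j v'
  proof -
    have p: "per (j + M + t) = per (j + t)" for t
      using perM[of "j + t" 1] by (simp add: algebra_simps)
    have e: "j + M + t + t' = j + t + t' + M" for t t' by simp
    have "labels P qP v' x (j + M + t) = labels P qP (\<lambda>i. v' (i + M)) x (j + t)" for x t
      by (simp add: labels_def qP_def p e)
    then have "letter_label P \<theta> lamP (labels P qP v') R (j + M) s =
        letter_label P \<theta> lamP (labels P qP (\<lambda>i. v' (i + M))) R j s" for s
      by (simp add: letter_label_def lamP_def p split: prod.split)
    then have "word_label P \<theta> lamP (labels P qP v') R (j + M) =
        word_label P \<theta> lamP (labels P qP (\<lambda>i. v' (i + M))) R j"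
      by (intro word_label_cong)
    then show ?thesis using perM[of j 1] by (simp add: solves_def zP_def)
  qed
  obtain k where k: "k > 0" "\<And>i. v (i + int k * M) = v i"
    using r.solution_periodic[OF P(2) \<open>M > 0\<close> shift v(1,3)] by blast
  define N where "N = int k * M"
  have "N > 0" using k \<open>M > 0\<close> by (simp add: N_def)
  have perN: "per (i + N) = per i" for i using perM by (simp add: N_def)
  have vN: "v (i + N + t) = v (i + t)" for i t
    using k(2)[of "i + t"] by (simp add: N_def algebra_simps)
  have "labelling Xs H P N lamP (labels P qP v)"
    unfolding labelling_def
  proof (intro conjI allI ballI)
    show "lamP i \<in> hom H P" for i using coP by (simp add: coefficients_def)
    show "lamP (i + N) h = lamP i h" for i h by (simp add: lamP_def perN)
    fix x i assume x: "x \<in> Xs"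
    show "labels P qP v x i \<in> carrier P" by (rule labels_closed[OF P(1) coP v(1) x])
    show "labels P qP v x (i + N) = labels P qP v x i" by (simp add: labels_def qP_def perN vN)
  qed
  then obtain \<Psi>' where \<Psi>': "represents Xs H P \<theta> N lamP (labels P qP v) \<Psi>'"
    using labelling_represents[OF H P(1)] by blast
  have val: "fst (\<Psi>' g) 0 = \<psi> (fst (\<Psi> g) 0)"
  proof (rule B0[OF \<Psi>'])
    fix i assume i: "\<bar>i\<bar> \<le> B0"
    then have "\<bar>i\<bar> \<le> B" "\<bar>i + \<alpha>\<bar> \<le> b" "\<bar>i + \<beta>\<bar> \<le> b" using C0 by (auto simp: B_def b_def)
    then show "lamP i h = \<psi> (lam i h)" and "x \<in> Xs \<Longrightarrow> labels P qP v x i = \<psi> (labels K q u x i)" for h x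
      using u(1) co
      by (auto simp: lamP_def labels_def qP_def per vu coefficients_def image_subset_iff)
  qed
  interpret \<Psi>': group_hom ?A "shift_wreath P N" \<Psi>'
    using \<Psi>' group_shift_wreath[OF P(1)] A.group_axioms
    by (simp add: group_hom_def group_hom_axioms_def represents_def)
  have r: "?r \<in> carrier ?A" "\<Psi>' ?r = (zP, 0)"
    using represents_relator[OF H P(1) \<Psi>' letters] closed v(3) by (auto simp: solves_def)
  \<comment> \<open>The displacement of the relator is 0, so its powers are taken vertex by
    vertex.\<close>
  have "(zP, 0) [^]\<^bsub>shift_wreath P N\<^esub> m = (\<lambda>i. zP i [^]\<^bsub>P\<^esub> m, 0)" for m :: nat
    by (induction m) (auto simp: shift_wreath_def)
  moreover have "zP i [^]\<^bsub>P\<^esub> n = \<one>\<^bsub>P\<^esub>" for i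
    using co zn[of "per i"] \<psi>.hom_nat_pow[of "z (per i)" n] by (simp add: zP_def coefficients_def)
  ultimately have "\<Psi>' (?r [^]\<^bsub>?A\<^esub> n) = \<one>\<^bsub>shift_wreath P N\<^esub>"
    using \<Psi>'.hom_nat_pow[OF r(1), of n] r(2) by (simp add: shift_wreath_def)
  then have "?r [^]\<^bsub>?A\<^esub> n \<in> kernel ?A (shift_wreath P N) \<Psi>'"
    using A.nat_pow_closed[OF r(1)] unfolding kernel_def by blast
  moreover have "g \<notin> kernel ?A (shift_wreath P N) \<Psi>'"
  proof
    assume "g \<in> kernel ?A (shift_wreath P N) \<Psi>'"
    then have "\<Psi>' g = (\<lambda>_. \<one>\<^bsub>P\<^esub>, 0)" unfolding kernel_def by (simp add: shift_wreath_def)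
    then show False using val P(4) by simp
  qed
  moreover have "finite (carrier (?A Mod kernel ?A (shift_wreath P N) \<Psi>'))"
    using \<Psi>'.finite_FactGroup_kernel finite_shift_wreath[OF P(2) \<open>N > 0\<close>] by blast
  ultimately show ?thesis using \<Psi>'.normal_kernel by blast
qed

text \<open>If the label of \<open>g\<close> over the universal group \<open>K\<close> is trivial at
  vertex 0, then so is its image under \<open>\<rho>\<close>, which is the class of
  \<open>g\<close>.\<close>

lemma residually_finite_power:
  assumes rf: "residually_finite H" and n: "n > 1"
  shows "residually_finite (presented_group Xs H (relator Xs H R [^]\<^bsub>ambient_group Xs H\<^esub> (n::nat)))"
proof -
  let ?A = "ambient_group Xs H" and ?r = "relator Xs H R"
  let ?rn = "?r [^]\<^bsub>?A\<^esub> n"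
  let ?C = "normal_closure ?A {?rn}"
  let ?inl = "free_product_inl H (free_group Xs)"
  let ?gen = "\<lambda>x. free_product_inr H (free_group Xs) (free_gen Xs x)"
  interpret A: group ?A by (rule group_ambient_group[OF H])
  have "(\<lambda>_. 0) \<in> hom H integer_group" by (auto simp: hom_def)
  then obtain \<Theta> where \<Theta>: "\<Theta> \<in> hom ?A integer_group" "\<And>h. h \<in> carrier H \<Longrightarrow> \<Theta> (?inl h) = 0"
    "\<And>x. x \<in> Xs \<Longrightarrow> \<Theta> (?gen x) = \<theta> x"
    using ambient_hom_exists[OF H group_integer_group, of "\<lambda>_. 0" Xs \<theta>]
    by (metis UNIV_I carrier_integer_group)
  have rA: "?r \<in> carrier ?A" "?rn \<in> carrier ?A"
  proof -
    have "R \<noteq> []" using s0 by auto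
    then have "relative_presentation Xs H R"
      using H letters by (simp add: relative_presentation_def)
    then show "?r \<in> carrier ?A" by (rule relator_closed)
    then show "?rn \<in> carrier ?A" by simp
  qed
  interpret C: normal ?C ?A using rA by (intro A.normal_closure_normal) simp
  define L where "L = ?A Mod ?C"
  define \<pi> where "\<pi> = (#>\<^bsub>?A\<^esub>) ?C"
  have L: "group L" and \<pi>: "\<pi> \<in> hom ?A L"
    using C.factorgroup_is_group C.r_coset_hom_Mod by (simp_all add: L_def \<pi>_def)
  interpret L: group L by (rule L)
  interpret \<pi>: group_hom ?A L \<pi>
    using L \<pi> A.group_axioms by (simp add: group_hom_def group_hom_axioms_def)
  have \<pi>1: "g \<in> ?C" if "g \<in> carrier ?A" "\<pi> g = \<one>\<^bsub>L\<^esub>" for g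
    using that A.rcos_self[OF that(1) C.subgroup_axioms] by (simp add: \<pi>_def L_def FactGroup_def)
  have "?rn \<in> ?C" by (auto simp: normal_closure_def)
  then have "\<pi> ?rn = \<one>\<^bsub>L\<^esub>"
    using A.coset_join2[OF rA(2) C.subgroup_axioms] by (simp add: \<pi>_def L_def FactGroup_def)
  then have rn: "\<pi> ?r [^]\<^bsub>L\<^esub> n = \<one>\<^bsub>L\<^esub>" using \<pi>.hom_nat_pow[OF rA(1)] by simp
  have gen: "?gen x \<in> carrier ?A" if "x \<in> Xs" for x using that H by simp
  have \<pi>gen: "\<pi> (?gen x) \<in> carrier L" if "x \<in> Xs" for x using gen[OF that] by simp
  \<comment> \<open>The value at \<open>b\<close> makes the constant sequence
    \<open>\<pi> (?gen a)\<close> reproduce the constant label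
    \<open>\<pi> (?gen b)\<close>.\<close>
  define c where "c x (i::int) = (if x \<notin> Xs then \<one>\<^bsub>L\<^esub> else if x = a then \<pi> (?gen a)
      else if x = b then \<pi> (?gen b) \<otimes>\<^bsub>L\<^esub> inv\<^bsub>L\<^esub> \<pi> (?gen a) else \<pi> (?gen x))" for x i
  have c: "c x i \<in> carrier L" for x i using \<pi>gen ab by (simp add: c_def)
  define \<phi> where "\<phi> (i::int) = \<pi> \<circ> ?inl" for i
  have \<phi>: "\<phi> i \<in> hom H L" for i
    unfolding \<phi>_def
    by (rule hom_compose[OF free_product_inl_hom \<pi>]) (rule group.is_monoid[OF H])
  have rL: "\<pi> ?r \<in> carrier L" using rA by simp
  obtain K :: "('x position \<times> 'h \<times> int \<times> int) list set monoid" and lam q and z :: "int \<Rightarrow> _" and \<rho>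
    where "residually_finite K" "\<forall>i. lam i \<in> hom H K" "\<forall>x i. q x i \<in> carrier K"
    "\<forall>i. z i \<in> carrier K \<and> z i [^]\<^bsub>K\<^esub> n = \<one>\<^bsub>K\<^esub>" "\<rho> \<in> hom K L"
    "\<forall>i. \<forall>h\<in>carrier H. \<rho> (lam i h) = \<phi> i h" "\<forall>x i. \<rho> (q x i) = c x i" "\<forall>i. \<rho> (z i) = \<pi> ?r"
    by (rule universal_coefficients[OF rf n L, of \<phi> c "\<lambda>_. \<pi> ?r", OF \<phi> c rL rn])
  then have K: "residually_finite K" "\<And>i. lam i \<in> hom H K" "\<And>x i. q x i \<in> carrier K"
    "\<And>i. z i \<in> carrier K" "\<And>i. z i [^]\<^bsub>K\<^esub> n = \<one>\<^bsub>K\<^esub>"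
    and \<rho>: "\<rho> \<in> hom K L" "\<And>i h. h \<in> carrier H \<Longrightarrow> \<rho> (lam i h) = \<phi> i h"
    "\<And>x i. \<rho> (q x i) = c x i" "\<And>i. \<rho> (z i) = \<pi> ?r"
    by simp_all
  have gK: "group K" using K(1) by (simp add: residually_finite_def)
  have co: "coefficients K lam q z" using K by (simp add: coefficients_def)
  interpret rK: reversible_recurrence w "carrier K" "solves K lam q z" by (rule recurrence[OF gK co])
  \<comment> \<open>The parameters \<open>q a i\<close> supply the free initial values of the
    recurrence; \<open>\<rho>\<close> sends them to \<open>\<pi> (?gen a)\<close>.\<close>
  have "range (q a) \<subseteq> carrier K" using K by auto
  from rK.solution_exists[OF this]
  obtain u where u: "range u \<subseteq> carrier K" "\<And>i. 0 \<le> i \<Longrightarrow> i < w \<Longrightarrow> u i = q a i"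
    "\<And>j. solves K lam q z j u"
    by blast
  have "labelling Xs H K 0 lam (labels K q u)"
    using labels_closed[OF gK co u(1)] K by (auto simp: labelling_def)
  then obtain \<Psi> where \<Psi>: "represents Xs H K \<theta> 0 lam (labels K q u) \<Psi>"
    by (rule labelling_represents[OF H gK])
  have coL: "coefficients L \<phi> c (\<lambda>_. \<pi> ?r)" using \<phi> c rA by (simp add: coefficients_def)
  let ?ua = "\<lambda>_::int. \<pi> (?gen a)"
  have labL: "labels L c ?ua x i = \<pi> (?gen x)" if "x \<in> Xs" for x i
    using that ab \<pi>gen by (auto simp: labels_def c_def L.m_assoc)
  have ua: "range ?ua \<subseteq> carrier L" using \<pi>gen ab by auto
  \<comment> \<open>The constant labelling over \<open>L\<close>: from every vertex the path of
    \<open>g\<close> has label \<open>\<pi> g\<close>. In particular the constant sequence solves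
    the equations with values \<open>\<pi> ?r\<close>.\<close>
  define \<Psi>0 where "\<Psi>0 g = (\<lambda>_::int. \<pi> g, \<Theta> g)" for g
  have \<Psi>0: "represents Xs H L \<theta> 0 \<phi> (labels L c ?ua) \<Psi>0"
    unfolding represents_def
  proof (intro conjI ballI)
    show "\<Psi>0 \<in> hom ?A (shift_wreath L 0)"
      using \<Theta>(1) by (auto simp: \<Psi>0_def hom_def shift_wreath_def)
    show "\<Psi>0 (?inl h) = (\<lambda>i. \<phi> i h, 0)" if "h \<in> carrier H" for h
      using \<Theta>(2)[OF that] by (simp add: \<Psi>0_def \<phi>_def)
    show "\<Psi>0 (?gen x) = (labels L c ?ua x, \<theta> x mod 0)" if "x \<in> Xs" for x
      using \<Theta>(3)[OF that] labL[OF that] by (simp add: \<Psi>0_def fun_eq_iff)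
  qed
  have "\<Psi>0 ?r = (word_label L \<theta> \<phi> (labels L c ?ua) R, 0)"
    using represents_relator[OF H L \<Psi>0 letters] closed by simp
  then have sola: "solves L \<phi> c (\<lambda>_. \<pi> ?r) j ?ua" for j
    by (simp add: \<Psi>0_def solves_def fun_eq_iff)
  interpret rL: reversible_recurrence w "carrier L" "solves L \<phi> c (\<lambda>_. \<pi> ?r)"
    by (rule recurrence[OF L coL])
  interpret \<rho>: group_hom K L \<rho>
    using gK L \<rho>(1) by (simp add: group_hom_def group_hom_axioms_def)
  have \<rho>uc: "range (\<rho> \<circ> u) \<subseteq> carrier L" using u(1) by (auto simp: image_subset_iff)
  have sol\<rho>: "solves L \<phi> c (\<lambda>_. \<pi> ?r) j (\<rho> \<circ> u)" for j
    by (rule solves_hom[OF gK L \<rho>(1) co u(1) _ _ _ u(3)]) (simp_all add: \<rho>)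
  \<comment> \<open>The image of \<open>u\<close> and the constant sequence solve the same
    recurrence with the same initial window.\<close>
  have \<rho>u: "\<rho> (u i) = \<pi> (?gen a)" for i
    using rL.solution_unique[OF \<rho>uc ua, of "\<bar>i\<bar>" i] sola sol\<rho> u(2) ab by (simp add: \<rho> c_def)
  have \<rho>lab: "\<rho> (labels K q u x i) = labels L c ?ua x i" for x i
    using u(1) K(3) by (simp add: labels_def \<rho>u \<rho>(3) image_subset_iff)
  have recover: "\<rho> (fst (\<Psi> g) 0) = \<pi> g" if g: "g \<in> carrier ?A" for g
  proof -
    obtain B where "\<forall>N lam' Y' \<Psi>'. represents Xs H L \<theta> N lam' Y' \<Psi>' \<longrightarrow>
      (\<forall>i. \<bar>i\<bar> \<le> B \<longrightarrow> (\<forall>h\<in>carrier H. lam' i h = \<rho> (lam i h)) \<and>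
        (\<forall>x\<in>Xs. Y' x i = \<rho> (labels K q u x i))) \<longrightarrow>
      fst (\<Psi>' g) 0 = \<rho> (fst (\<Psi> g) 0)"
      using represents_local[OF H gK L \<rho>(1) \<Psi> g, of 0] by blast
    then have "fst (\<Psi>0 g) 0 = \<rho> (fst (\<Psi> g) 0)"
      using \<Psi>0 \<rho>(2) \<rho>lab by blast
    then show ?thesis by (simp add: \<Psi>0_def)
  qed
  show ?thesis
  proof (rule residually_finite_presented_group[OF H rA(2)])
    fix g assume g: "g \<in> carrier ?A" "g \<notin> ?C"
    then have "fst (\<Psi> g) 0 \<noteq> \<one>\<^bsub>K\<^esub>" using recover[OF g(1)] \<pi>1[OF g(1)] by auto
    then show "\<exists>N. N \<lhd> ?A \<and> finite (carrier (?A Mod N)) \<and> ?rn \<in> N \<and> g \<notin> N"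
      by (rule periodic_finite_quotient[OF K(1) co K(5) u(1,3) \<Psi> g(1)])
  qed
qed

end

theorem theorem3:
  fixes Xs :: "'x set" and H :: "('h, 'c) monoid_scheme"
    and R :: "('x \<times> int \<times> 'h) list" and n :: nat
  assumes "group H"
    and "M_presentation Xs H R"
    and "residually_finite (presented_group Xs H (relator Xs H R))"
    and "n > 1"
  shows "residually_finite (presented_group Xs H (relator Xs H R [^]\<^bsub>ambient_group Xs H\<^esub> n))"
proof -
  obtain \<theta> a b \<alpha> \<beta> w s0 s1 where "max_min_word Xs H R \<theta> a b \<alpha> \<beta> w s0 s1"
    by (rule max_min_word_exists[OF assms(2)])
  then interpret max_min_word Xs H R \<theta> a b \<alpha> \<beta> w s0 s1 .
  show ?thesis
    using residually_finite_power residually_finite_coefficient_group[OF assms(2,3)] assms(4) by blast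
qed

end
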